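(* Let $f\in C(\mathbb{R}_+;\mathbb{C}_-)$ and let $K\in L^2_{\mathrm{loc}}(\mathbb{R}_+;\mathbb{R})$ be a kernel which is nonnegative, nonincreasing, not identically zero and continuously differentiable on $(0,\infty)$, and whose resolvent of the first kind $L$ is nonnegative and nonincreasing, i.e. $s\mapsto L([s,s+t])$ is nonincreasing for every $t\ge0$. Let $b\in\mathbb{R}$, $c\ge0$, and let $\nu$ be a nonnegative measure on $\mathbb{R}_+$ with $\nu(\{0\})=0$ and $\int_{\mathbb{R}_+}|\xi|^2\nu(\mathrm{d}\xi)<\infty$. Set $$F(t,u)=f(t)+bu+\frac c2u^2+\int_{\mathbb{R}_+}(e^{u\xi}-1-u\xi)\,\nu(\mathrm{d}\xi),\quad (t,u)\in\mathbb{R}_+\times\mathbb{C}_-,$$ $$\overline F(t,u)=\mathrm{Re}f(t)+bu+\frac c2u^2+\int_{\mathbb{R}_+}(e^{u\xi}-1-u\xi)\,\nu(\mathrm{d}\xi),\quad (t,u)\in\mathbb{R}_+\times\mathbb{R}_-,$$ and consider the Riccati--Volterra equations $$(1)\quad \psi(t)=\int_0^tK(t-s)F(s,\psi(s))\,\mathrm{d}s,\ t\ge0;\qquad (2)\quad \overline\psi(t)=\int_0^tK(t-s)\overline F(s,\overline\psi(s))\,\mathrm{d}s,\ t\ge0.$$ Then: (i) There exist a continuous global solution $\psi\in C(\mathbb{R}_+;\mathbb{C}_-)$ of (1) and a real-valued, continuous global solution $\overline\psi\in C(\mathbb{R}_+;\mathbb{R}_-)$ of (2). (ii) Given any $\psi\in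 C(\mathbb{R}_+;\mathbb{C}_-)$ and $\overline\psi\in C(\mathbb{R}_+;\mathbb{R}_-)$ satisfying (1) and (2), respectively, one has $$\mathrm{Re}\,\psi(t)\le\overline\psi(t),\qquad t\ge0.$$
   Context: $\mathbb{R}_+=[0,\infty)$, $\mathbb{R}_-=(-\infty,0]$, $\mathbb{C}_-=\{z\in\mathbb{C}:\mathrm{Re}\,z\le0\}$. The resolvent of the first kind of $K$ is the (unique, assumed to exist) locally finite measure $L$ on $\mathbb{R}_+$ with $(K\ast L)(t)=\int_{[0,t]}K(t-s)L(\mathrm{d}s)=1$ (and likewise $L\ast K=1$). *)

theory Defs
  imports "HOL-Analysis.Analysis"
begin

definition complex_nonpos :: "complex set" where
  "complex_nonpos = {z. Re z \<le> 0}"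

(* A nonnegative Borel measure on [0,\<infinity>) is encoded as a Borel measure on the whole line
   that does not charge the negative half-line. *)
definition measure_on_Rplus :: "real measure \<Rightarrow> bool" where
  "measure_on_Rplus M \<longleftrightarrow> sets M = sets borel \<and> emeasure M {..<0} = 0"

definition locally_finite_on_Rplus :: "real measure \<Rightarrow> bool" where
  "locally_finite_on_Rplus M \<longleftrightarrow> (\<forall>t\<ge>0. emeasure M {0..t} < \<infinity>)"

definition L2_loc :: "(real \<Rightarrow> real) \<Rightarrow> bool" where
  "L2_loc K \<longleftrightarrow> set_borel_measurable lborel {0..} K \<and>
     (\<forall>T\<ge>0. set_integrable lborel {0..T} (\<lambda>t. (K t)\<^sup>2))"

definition measure_convolution :: "(real \<Rightarrow> real) \<Rightarrow> real measure \<Rightarrow> real \<Rightarrow> real" where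
  "measure_convolution K L t = (LINT s:{0..t}|L. K (t - s))"

(* For scalar kernels K * L and L * K are the same integral, so K * L = 1 is the only condition.
   It is imposed for t > 0: kernels are L^2_loc functions, possibly singular at 0, so K 0 carries
   no meaning and K * L at t = 0 is understood by right-continuous extension.
   The Bochner integral of a non-integrable function is 0, so the equation includes
   integrability. *)
definition resolvent_first_kind :: "(real \<Rightarrow> real) \<Rightarrow> real measure \<Rightarrow> bool" where
  "resolvent_first_kind K L \<longleftrightarrow> measure_on_Rplus L \<and> locally_finite_on_Rplus L \<and>
     (\<forall>t>0. measure_convolution K L t = 1)"

definition nonincreasing_measure :: "real measure \<Rightarrow> bool" where
  "nonincreasing_measure L \<longleftrightarrow> (\<forall>t\<ge>0. antimono_on {0..} (\<lambda>s. emeasure L {s..s+t}))"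

definition riccati_F ::
  "(real \<Rightarrow> complex) \<Rightarrow> real \<Rightarrow> real \<Rightarrow> real measure \<Rightarrow> real \<Rightarrow> complex \<Rightarrow> complex" where
  "riccati_F f b c \<nu> t u = f t + of_real b * u + of_real (c / 2) * u\<^sup>2
     + (LINT \<xi>:{0..}|\<nu>. exp (u * of_real \<xi>) - 1 - u * of_real \<xi>)"

definition riccati_Fbar ::
  "(real \<Rightarrow> complex) \<Rightarrow> real \<Rightarrow> real \<Rightarrow> real measure \<Rightarrow> real \<Rightarrow> real \<Rightarrow> real" where
  "riccati_Fbar f b c \<nu> t u = Re (f t) + b * u + c / 2 * u\<^sup>2
     + (LINT \<xi>:{0..}|\<nu>. exp (u * \<xi>) - 1 - u * \<xi>)"

definition continuous_volterra_solution ::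
  "(real \<Rightarrow> real) \<Rightarrow> (real \<Rightarrow> 'a \<Rightarrow> 'a) \<Rightarrow> 'a set \<Rightarrow>
   (real \<Rightarrow> 'a::{banach, second_countable_topology}) \<Rightarrow> bool" where
  "continuous_volterra_solution K G D \<psi> \<longleftrightarrow>
     continuous_on {0..} \<psi> \<and> \<psi> \<in> {0..} \<rightarrow> D \<and>
     (\<forall>t\<ge>0. \<psi> t = (LINT s:{0..t}|lborel. K (t - s) *\<^sub>R G s (\<psi> s)))"

end

theory Submission
  imports Defs
begin

text \<open>
  Everything rests on a comparison principle: if \<open>d = K * g\<close> and \<open>g \<ge> C d\<close> wherever \<open>d \<le> 0\<close>,
  then \<open>d \<ge> 0\<close>.  The resolvent \<open>L\<close> enters only through the following memory property: if
  \<open>d = K * g\<close> is nonnegative on \<open>[0, \<tau>]\<close>, then so is the contribution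
  \<open>\<integral>\<^sub>0\<^sup>\<tau> K(\<tau> + h - s) g(s) ds\<close> of the past to every later time.  Indeed, with \<open>k(u) = K(u + h)\<close> the
  function \<open>k * L = 1 - \<integral>\<^bsub>[u, u + h]\<^esub> K(u + h - s) L(ds)\<close> is nondecreasing because \<open>L\<close> is
  nonincreasing, and \<open>1 * (k * g) = (k * L) * d\<close>; hence \<open>1 * (k * g)\<close> is nondecreasing on
  \<open>[0, \<tau>]\<close> and its derivative at \<open>\<tau>\<close> is nonnegative.  Adding a small multiple of the solution of
  \<open>z = K * (1 + C z)\<close> to \<open>d\<close> makes \<open>g\<close> strictly positive at the first exit time from
  \<open>[0, \<infinity>)\<close>, so that there is none.

  Comparing with linear equations bounds every solution of (1) in terms of the data, and the
  nonlinearity may be truncated to be globally Lipschitz; Picard iteration then gives existence.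
  For real data the imaginary part vanishes, again by comparison, which settles (2).  Part (ii) is
  the comparison principle for \<open>d = \<psi>bar - Re \<psi>\<close>.
\<close>

section \<open>Volterra convolution and Picard iteration\<close>

lemma continuous_on_atLeast_imp_Icc:
  fixes g :: "real \<Rightarrow> 'a::topological_space"
  shows "continuous_on {a..} g \<Longrightarrow> continuous_on {a..b} g"
  by (erule continuous_on_subset) auto

lemma set_integral_reflect:
  fixes f :: "real \<Rightarrow> 'a::{banach, second_countable_topology}"
  shows "(LINT s:{0..t}|lborel. f (t - s)) = (LINT s:{0..t}|lborel. f s)"
proof -
  have "(LINT s:{0..t}|lborel. f s)
      = \<bar>-1\<bar> *\<^sub>R (LINT s|lborel. indicator {0..t} (t + -1 * s) *\<^sub>R f (t + -1 * s))"
    unfolding set_lebesgue_integral_def by (rule lborel_integral_real_affine) simp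
  also have "\<dots> = (LINT s:{0..t}|lborel. f (t - s))"
    unfolding set_lebesgue_integral_def
    by (auto intro!: Bochner_Integration.integral_cong split: split_indicator)
  finally show ?thesis ..
qed

lemma set_integrable_reflect:
  fixes f :: "real \<Rightarrow> 'a::{banach, second_countable_topology}"
  shows "set_integrable lborel {0..t} (\<lambda>s. f (t - s)) \<longleftrightarrow> set_integrable lborel {0..t} f"
proof -
  have "(\<lambda>s. indicator {0..t} (t + -1 * s) *\<^sub>R f (t + -1 * s)) = (\<lambda>s. indicator {0..t} s *\<^sub>R f (t - s))"
    by (auto simp: fun_eq_iff split: split_indicator)
  with lborel_integrable_real_affine_iff[of "-1" "\<lambda>s. indicator {0..t} s *\<^sub>R f s" t]
  show ?thesis unfolding set_integrable_def by simp
qed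

text \<open>Scaling by the real kernel lets one operator serve real and complex equations
  alike.\<close>

definition volterra :: "(real \<Rightarrow> real) \<Rightarrow> (real \<Rightarrow> 'a) \<Rightarrow> real \<Rightarrow> 'a::{banach, second_countable_topology}"
  where "volterra K g t = (LINT s:{0..t}|lborel. K (t - s) *\<^sub>R g s)"

lemma volterra_reflect: "volterra K g t = (LINT s:{0..t}|lborel. K s *\<^sub>R g (t - s))"
  using set_integral_reflect[where f = "\<lambda>s. K s *\<^sub>R g (t - s)" and t = t] by (simp add: volterra_def)

lemma volterra_cong:
  assumes "\<And>s. 0 \<le> s \<Longrightarrow> s \<le> t \<Longrightarrow> g s = g' s"
  shows "volterra K g t = volterra K g' t"
  unfolding volterra_def by (rule set_lebesgue_integral_cong) (use assms in auto)

text \<open>The sign of \<open>K\<close> is prescribed off 0, since \<open>K 0\<close> carries no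
  meaning; pointwise estimates below therefore discard the single time at which the argument of
  \<open>K\<close> vanishes.\<close>

locale volterra_kernel =
  fixes K :: "real \<Rightarrow> real"
  assumes K_integrable: "set_integrable lborel {0..T} K"
    and K_nonneg: "0 < t \<Longrightarrow> 0 \<le> K t"
begin

lemma integrable_conv_reflected:
  fixes g :: "real \<Rightarrow> 'a::{banach, second_countable_topology}"
  assumes g: "continuous_on {0..t} g"
  shows "set_integrable lborel {0..t} (\<lambda>s. K s *\<^sub>R g (t - s))"
proof -
  have cont: "continuous_on {0..t} (\<lambda>s. g (t - s))"
    by (rule continuous_on_compose2[OF g]) (auto intro!: continuous_intros)
  then have "bounded ((\<lambda>s. g (t - s)) ` {0..t})"
    by (intro compact_imp_bounded compact_continuous_image) auto
  then obtain B where B: "\<And>s. s \<in> {0..t} \<Longrightarrow> norm (g (t - s)) \<le> B"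
    unfolding bounded_iff by blast
  have [measurable]: "(\<lambda>s. indicator {0..t} s *\<^sub>R K s) \<in> borel_measurable lborel"
    using K_integrable[of t] unfolding set_integrable_def by auto
  have [measurable]: "(\<lambda>s. indicator {0..t} s *\<^sub>R g (t - s)) \<in> borel_measurable lborel"
    using borel_measurable_continuous_on_indicator[OF _ cont] by simp
  have "(\<lambda>s. (indicator {0..t} s *\<^sub>R K s) *\<^sub>R (indicator {0..t} s *\<^sub>R g (t - s))) \<in> borel_measurable lborel"
    by measurable
  also have "(\<lambda>s. (indicator {0..t} s *\<^sub>R K s) *\<^sub>R (indicator {0..t} s *\<^sub>R g (t - s)))
      = (\<lambda>s. indicator {0..t} s *\<^sub>R K s *\<^sub>R g (t - s))"
    by (auto simp: fun_eq_iff split: split_indicator)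
  finally have meas: "set_borel_measurable lborel {0..t} (\<lambda>s. K s *\<^sub>R g (t - s))"
    by (simp add: set_borel_measurable_def)
  have "norm (K s *\<^sub>R g (t - s)) \<le> norm (B * K s)" if "s \<in> {0..t}" for s
    using mult_left_mono[OF order_trans[OF B[OF that] abs_ge_self], of "\<bar>K s\<bar>"]
    by (simp add: abs_mult mult.commute)
  then show ?thesis
    using set_integrable_bound[OF set_integrable_mult_right[OF K_integrable] meas] by blast
qed

lemma integrable_conv:
  fixes g :: "real \<Rightarrow> 'a::{banach, second_countable_topology}"
  assumes g: "continuous_on {0..t} g"
  shows "set_integrable lborel {0..t} (\<lambda>s. K (t - s) *\<^sub>R g s)"
  using set_integrable_reflect[of t "\<lambda>s. K s *\<^sub>R g (t - s)"] integrable_conv_reflected[OF g] by simp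

text \<open>In reflected form the kernel stays fixed, and time enters through the continuous
  \<open>g\<close> and the domain. Dominated convergence with majorant B |K| on a common interval
  [0, T] then applies even if \<open>K\<close> is singular at 0.\<close>

lemma volterra_continuous:
  fixes g :: "real \<Rightarrow> 'a::{banach, second_countable_topology}"
  assumes g: "continuous_on {0..} g"
  shows "continuous_on {0..} (volterra K g)"
proof -
  have "(volterra K g \<circ> x) \<longlonglongrightarrow> volterra K g a"
    if x: "\<forall>n. x n \<in> {0..}" "x \<longlonglongrightarrow> a" and a: "a \<in> {0..}" for x a
  proof -
    obtain T where T: "\<And>n. x n \<le> T"
      using x(2) by (metis Bseq_def abs_le_D1 convergentI convergent_imp_Bseq real_norm_def)
    have aT: "a \<le> T" using LIMSEQ_le_const2[OF x(2)] T by blast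
    have "bounded (g ` {0..T})"
      by (intro compact_imp_bounded compact_continuous_image continuous_on_subset[OF g]) auto
    then obtain B where B: "\<And>s. s \<in> {0..T} \<Longrightarrow> norm (g s) \<le> B"
      unfolding bounded_iff by blast
    let ?f = "\<lambda>t s. indicator {0..t} s *\<^sub>R (K s *\<^sub>R g (t - s))"
    have int: "integrable lborel (?f t)" for t
      using integrable_conv_reflected[OF continuous_on_subset[OF g]] by (auto simp: set_integrable_def)
    have "(\<lambda>n. LINT s|lborel. ?f (x n) s) \<longlonglongrightarrow> (LINT s|lborel. ?f a s)"
    proof (rule integral_dominated_convergence[where w = "\<lambda>s. \<bar>B\<bar> * \<bar>indicator {0..T} s *\<^sub>R K s\<bar>"])
      show "integrable lborel (\<lambda>s. \<bar>B\<bar> * \<bar>indicator {0..T} s *\<^sub>R K s\<bar>)"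
        using K_integrable[of T] by (simp add: set_integrable_def)
      show "AE s in lborel. norm (?f (x n) s) \<le> \<bar>B\<bar> * \<bar>indicator {0..T} s *\<^sub>R K s\<bar>" for n
      proof (rule AE_I2)
        fix s
        show "norm (?f (x n) s) \<le> \<bar>B\<bar> * \<bar>indicator {0..T} s *\<^sub>R K s\<bar>"
        proof (cases "s \<in> {0..x n}")
          case True
          with T[of n] have "norm (g (x n - s)) \<le> \<bar>B\<bar>" "s \<le> T"
            using order_trans[OF B abs_ge_self, of "x n - s"] by auto
          with True mult_left_mono[of "norm (g (x n - s))" "\<bar>B\<bar>" "\<bar>K s\<bar>"] show ?thesis by (simp add: mult.commute)
        qed auto
      qed
      \<comment> \<open>The indicators of [0, x n] need not converge at the endpoint
        \<open>s = a\<close>, which is a null set.\<close>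
      show "AE s in lborel. (\<lambda>n. ?f (x n) s) \<longlonglongrightarrow> ?f a s"
        using AE_lborel_singleton[of a]
      proof eventually_elim
        fix s assume "s \<noteq> a"
        then consider "s < 0" | "s > a" | "0 \<le> s" "s < a" by linarith
        then show "(\<lambda>n. ?f (x n) s) \<longlonglongrightarrow> ?f a s"
        proof cases
          case 1 then show ?thesis by simp
        next
          case 2
          then have "\<forall>\<^sub>F n in sequentially. x n < s" using order_tendstoD(2)[OF x(2)] by blast
          then have "\<forall>\<^sub>F n in sequentially. ?f (x n) s = 0" by eventually_elim auto
          with 2 show ?thesis by (auto intro: tendsto_eventually)
        next
          case 3
          then have ev: "\<forall>\<^sub>F n in sequentially. s < x n" using order_tendstoD(1)[OF x(2)] by blast
          have "(\<lambda>n. g (x n - s)) \<longlonglongrightarrow> g (a - s)"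
            by (rule continuous_on_tendsto_compose[OF g])
              (use 3 x(2) in \<open>auto intro!: tendsto_intros eventually_mono[OF ev]\<close>)
          then have "(\<lambda>n. K s *\<^sub>R g (x n - s)) \<longlonglongrightarrow> ?f a s"
            using 3 by (auto intro!: tendsto_intros)
          moreover have "\<forall>\<^sub>F n in sequentially. K s *\<^sub>R g (x n - s) = ?f (x n) s"
            using ev by eventually_elim (use 3 in auto)
          ultimately show ?thesis by (rule Lim_transform_eventually)
        qed
      qed
    qed (use int in auto)
    then show ?thesis by (simp add: volterra_reflect set_lebesgue_integral_def comp_def)
  qed
  then show ?thesis unfolding continuous_on_sequentially by blast
qed

lemma volterra_norm_le:
  fixes g :: "real \<Rightarrow> 'a::{banach, second_countable_topology}"
  assumes "continuous_on {0..t} g" "continuous_on {0..t} h" "\<And>s. s \<in> {0..t} \<Longrightarrow> norm (g s) \<le> h s"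
  shows "norm (volterra K g t) \<le> volterra K h t"
proof -
  have "norm (volterra K g t) \<le> (LINT s:{0..t}|lborel. norm (K (t - s) *\<^sub>R g s))"
    unfolding volterra_def by (rule set_integral_norm_bound[OF integrable_conv[OF assms(1)]])
  also have "\<dots> = (LINT s|lborel. indicator {0..t} s *\<^sub>R norm (K (t - s) *\<^sub>R g s))"
    by (simp add: set_lebesgue_integral_def)
  also have "\<dots> \<le> (LINT s|lborel. indicator {0..t} s *\<^sub>R (K (t - s) *\<^sub>R h s))"
  proof (rule integral_mono_AE)
    show "integrable lborel (\<lambda>s. indicator {0..t} s *\<^sub>R norm (K (t - s) *\<^sub>R g s))"
      using set_integrable_norm[OF integrable_conv[OF assms(1)]] by (simp add: set_integrable_def)
    show "integrable lborel (\<lambda>s. indicator {0..t} s *\<^sub>R (K (t - s) *\<^sub>R h s))"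
      using integrable_conv[OF assms(2)] by (simp add: set_integrable_def)
    show "AE s in lborel. indicator {0..t} s *\<^sub>R norm (K (t - s) *\<^sub>R g s) \<le> indicator {0..t} s *\<^sub>R (K (t - s) *\<^sub>R h s)"
      using AE_lborel_singleton[of t]
      by eventually_elim (use K_nonneg assms(3) in \<open>auto split: split_indicator intro!: mult_mono\<close>)
  qed
  also have "\<dots> = volterra K h t" by (simp add: volterra_def set_lebesgue_integral_def)
  finally show ?thesis .
qed

text \<open>A nonnegative \<open>g\<close> serves as its own majorant in the norm bound.\<close>

lemma volterra_nonneg:
  fixes g :: "real \<Rightarrow> real"
  assumes "continuous_on {0..t} g" "\<And>s. s \<in> {0..t} \<Longrightarrow> 0 \<le> g s"
  shows "0 \<le> volterra K g t"
  using volterra_norm_le[OF assms(1) assms(1)] assms(2) by (metis norm_ge_zero order_trans real_norm_def abs_of_nonneg order_refl)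

lemma volterra_add:
  fixes g :: "real \<Rightarrow> 'a::{banach, second_countable_topology}"
  assumes "continuous_on {0..t} g" "continuous_on {0..t} h"
  shows "volterra K (\<lambda>s. g s + h s) t = volterra K g t + volterra K h t"
  using set_integral_add(2)[OF integrable_conv[OF assms(1)] integrable_conv[OF assms(2)]]
  by (simp add: volterra_def scaleR_add_right)

lemma volterra_diff:
  fixes g :: "real \<Rightarrow> 'a::{banach, second_countable_topology}"
  assumes "continuous_on {0..t} g" "continuous_on {0..t} h"
  shows "volterra K (\<lambda>s. g s - h s) t = volterra K g t - volterra K h t"
  using set_integral_diff(2)[OF integrable_conv[OF assms(1)] integrable_conv[OF assms(2)]]
  by (simp add: volterra_def scaleR_diff_right)

lemma volterra_cmult:
  fixes g :: "real \<Rightarrow> real"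
  shows "volterra K (\<lambda>s. c * g s) t = c * volterra K g t"
  unfolding volterra_def by (simp add: mult.left_commute)

section \<open>Picard iteration in an exponentially weighted norm\<close>

text \<open>Dominated convergence as \<open>l\<close> grows through the integers. In the norm sup
  exp(-l t) |x(t)| on [0, T], convolution with \<open>K\<close> has norm at most this integral, so a
  large rate beats any Lipschitz constant.\<close>

lemma exp_weight_small:
  assumes "0 < \<epsilon>"
  obtains l where "(LINT s:{0..T}|lborel. K s * exp (- l * s)) < \<epsilon>" "0 \<le> l"
proof -
  have Km[measurable]: "(\<lambda>s. indicator {0..T} s *\<^sub>R K s) \<in> borel_measurable lborel"
    using K_integrable[of T] unfolding set_integrable_def by auto
  have "(\<lambda>n. LINT s|lborel. (indicator {0..T} s *\<^sub>R K s) * exp (- real n * s)) \<longlonglongrightarrow> (LINT s::real|lborel. 0)"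
  proof (rule integral_dominated_convergence[where w = "\<lambda>s. \<bar>indicator {0..T} s *\<^sub>R K s\<bar>"])
    show "integrable lborel (\<lambda>s. \<bar>indicator {0..T} s *\<^sub>R K s\<bar>)"
      using K_integrable[of T] by (simp add: set_integrable_def)
    show "AE s in lborel. norm ((indicator {0..T} s *\<^sub>R K s) * exp (- real n * s)) \<le> \<bar>indicator {0..T} s *\<^sub>R K s\<bar>" for n
      by (intro AE_I2) (auto split: split_indicator simp: abs_mult mult_left_le)
    show "AE s in lborel. (\<lambda>n. (indicator {0..T} s *\<^sub>R K s) * exp (- real n * s)) \<longlonglongrightarrow> 0"
      using AE_lborel_singleton[of 0]
    proof eventually_elim
      fix s :: real assume "s \<noteq> 0"
      show "(\<lambda>n. (indicator {0..T} s *\<^sub>R K s) * exp (- real n * s)) \<longlonglongrightarrow> 0"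
      proof (cases "0 < s")
        case True
        have "(\<lambda>n. exp (-s) ^ n) \<longlonglongrightarrow> 0" by (rule LIMSEQ_power_zero) (use True in auto)
        then have "(\<lambda>n. exp (- real n * s)) \<longlonglongrightarrow> 0" by (simp add: exp_of_nat_mult[symmetric])
        then show ?thesis by (rule tendsto_mult_right_zero)
      qed (use \<open>s \<noteq> 0\<close> in auto)
    qed
    show "(\<lambda>s. (indicator {0..T} s *\<^sub>R K s) * exp (- real n * s)) \<in> borel_measurable lborel" for n
      by measurable
  qed auto
  then have "(\<lambda>n. LINT s:{0..T}|lborel. K s * exp (- real n * s)) \<longlonglongrightarrow> 0"
    by (simp add: set_lebesgue_integral_def mult.assoc)
  then have "\<forall>\<^sub>F n in sequentially. (LINT s:{0..T}|lborel. K s * exp (- real n * s)) < \<epsilon>"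
    using assms by (rule order_tendstoD)
  then obtain n where "(LINT s:{0..T}|lborel. K s * exp (- real n * s)) < \<epsilon>"
    by (meson eventually_happens sequentially_bot)
  with that[of "real n"] show ?thesis by simp
qed

text \<open>The iterates do not depend on T, although the rate of the weighted norm does; geometric
  decay of their differences on every [0, T] gives one limit on the whole half-line. Continuity of
  \<open>G\<close> is asked for along continuous paths, a form that suits the time-dependent
  truncation used later.\<close>

theorem volterra_lipschitz_existence:
  fixes G :: "real \<Rightarrow> 'a \<Rightarrow> 'a::{banach, second_countable_topology}"
  assumes cont: "\<And>\<psi>. continuous_on {0..} \<psi> \<Longrightarrow> continuous_on {0..} (\<lambda>s. G s (\<psi> s))"
    and lip: "\<And>T. \<exists>C. \<forall>s\<in>{0..T}. \<forall>u v. norm (G s u - G s v) \<le> C * norm (u - v)"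
  obtains \<psi> where "continuous_on {0..} \<psi>" "\<And>t. 0 \<le> t \<Longrightarrow> \<psi> t = volterra K (\<lambda>s. G s (\<psi> s)) t"
proof -
  define V where "V \<psi> = volterra K (\<lambda>s. G s (\<psi> s))" for \<psi>
  define x where "x n = (V ^^ n) (\<lambda>_. 0)" for n
  have x_Suc: "x (Suc n) = V (x n)" for n by (simp add: x_def)
  have x_cont: "continuous_on {0..} (x n)" for n
    by (induction n) (auto simp: x_def V_def intro!: volterra_continuous cont)
  have x_cont': "continuous_on {0..t} (x n)" for n t
    by (rule continuous_on_subset[OF x_cont]) auto
  have G_cont: "continuous_on {0..t} (\<lambda>s. G s (\<psi> s))" if "continuous_on {0..} \<psi>" for t \<psi>
    by (rule continuous_on_subset[OF cont[OF that]]) auto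
  have contraction: "\<exists>C l. 0 \<le> C \<and> (\<forall>n. \<forall>t\<in>{0..T}. norm (x (Suc n) t - x n t) \<le> C * exp (l * t) * (1/2) ^ n)"
    for T
  proof -
    obtain M where M: "\<And>s u v. s \<in> {0..T} \<Longrightarrow> norm (G s u - G s v) \<le> M * norm (u - v)"
      using lip by metis
    \<comment> \<open>A strictly positive Lipschitz constant can be divided by; the threshold 1 / (2
      M') below makes the contraction factor 1/2.\<close>
    define M' where "M' = \<bar>M\<bar> + 1"
    have M': "norm (G s u - G s v) \<le> M' * norm (u - v)" if "s \<in> {0..T}" for s u v
    proof -
      have "M * norm (u - v) \<le> M' * norm (u - v)" by (rule mult_right_mono) (auto simp: M'_def)
      with M[OF that, of u v] show ?thesis by linarith
    qed
    have M'_pos: "0 < M'" by (auto simp: M'_def)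
    obtain l where l: "(LINT s:{0..T}|lborel. K s * exp (- l * s)) < 1 / (2 * M')" "0 \<le> l"
      using exp_weight_small[of "1 / (2 * M')" T] M'_pos by auto
    have "bounded (x 1 ` {0..T})"
      by (intro compact_imp_bounded compact_continuous_image x_cont') auto
    then obtain C where C: "\<And>s. s \<in> {0..T} \<Longrightarrow> norm (x 1 s) \<le> C"
      unfolding bounded_iff by blast
    have "norm (x (Suc n) t - x n t) \<le> \<bar>C\<bar> * exp (l * t) * (1/2) ^ n" if "t \<in> {0..T}" for n t
      using that
    proof (induction n arbitrary: t)
      case 0
      have "\<bar>C\<bar> \<le> \<bar>C\<bar> * exp (l * t)" using 0 l(2) by (simp add: mult_le_cancel_left1)
      with C[OF 0] show ?case by (auto simp: x_def)
    next
      case (Suc n)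
      let ?c = "M' * (\<bar>C\<bar> * (1/2) ^ n)"
      have c0: "0 \<le> ?c" using M'_pos by auto
      have "norm (x (Suc (Suc n)) t - x (Suc n) t)
          = norm (volterra K (\<lambda>s. G s (x (Suc n) s) - G s (x n s)) t)"
        unfolding x_Suc[of "Suc n"] V_def
        by (subst (2) x_Suc) (simp add: V_def volterra_diff G_cont[OF x_cont])
      also have "\<dots> \<le> volterra K (\<lambda>s. ?c * exp (l * s)) t"
      proof (rule volterra_norm_le)
        fix s assume s: "s \<in> {0..t}"
        then have "norm (G s (x (Suc n) s) - G s (x n s)) \<le> M' * norm (x (Suc n) s - x n s)"
          using Suc.prems by (intro M') auto
        also have "\<dots> \<le> M' * (\<bar>C\<bar> * exp (l * s) * (1/2) ^ n)"
          using M'_pos s Suc.prems by (intro mult_left_mono Suc.IH) auto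
        finally show "norm (G s (x (Suc n) s) - G s (x n s)) \<le> ?c * exp (l * s)"
          by (simp add: mult_ac)
      qed (auto intro!: continuous_intros G_cont[OF x_cont])
      also have "\<dots> = ?c * volterra K (\<lambda>s. exp (l * s)) t" by (rule volterra_cmult)
      \<comment> \<open>Factoring out exp(l t) leaves the integral that \<open>l\<close> was chosen
        to make small.\<close>
      also have "volterra K (\<lambda>s. exp (l * s)) t = exp (l * t) * (LINT s:{0..t}|lborel. K s * exp (- l * s))"
      proof -
        have "K s * exp (l * (t - s)) = exp (l * t) * (K s * exp (- (l * s)))" for s
          by (simp add: exp_diff exp_minus right_diff_distrib divide_inverse)
        then have "(LINT s:{0..t}|lborel. K s * exp (l * (t - s))) = (LINT s:{0..t}|lborel. exp (l * t) * (K s * exp (- (l * s))))"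
          by (intro set_lebesgue_integral_cong) auto
        then show ?thesis unfolding volterra_reflect by simp
      qed
      also have "(LINT s:{0..t}|lborel. K s * exp (- l * s)) \<le> (LINT s:{0..T}|lborel. K s * exp (- l * s))"
      proof -
        have int: "set_integrable lborel {0..r} (\<lambda>s. K s * exp (- l * s))" for r
        proof -
          have "continuous_on {0..r} (\<lambda>s. exp (- l * (r - s)))" by (intro continuous_intros)
          from integrable_conv_reflected[OF this] show ?thesis by simp
        qed
        show ?thesis unfolding set_lebesgue_integral_def
        proof (rule integral_mono_AE)
          show "AE s in lborel. indicator {0..t} s *\<^sub>R (K s * exp (- l * s)) \<le> indicator {0..T} s *\<^sub>R (K s * exp (- l * s))"
            using AE_lborel_singleton[of 0]
            by eventually_elim (use Suc.prems K_nonneg in \<open>auto split: split_indicator\<close>)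
        qed (use int in \<open>auto simp: set_integrable_def\<close>)
      qed
      also have "\<dots> \<le> 1 / (2 * M')" using l by simp
      finally have "norm (x (Suc (Suc n)) t - x (Suc n) t) \<le> ?c * (exp (l * t) * (1 / (2 * M')))"
        using c0 by (simp add: mult_left_mono)
      also have "\<dots> = \<bar>C\<bar> * exp (l * t) * (1/2) ^ Suc n" using M'_pos by (simp add: field_simps)
      finally show ?case .
    qed
    then show ?thesis by (intro exI[of _ "\<bar>C\<bar>"] exI[of _ l]) auto
  qed
  \<comment> \<open>The limit is written as the telescoping series of the differences, starting from
    \<open>x 0 = 0\<close>, so that the Weierstrass test gives uniform convergence on every
    [0, T].\<close>
  define \<psi> where "\<psi> t = (\<Sum>n. x (Suc n) t - x n t)" for t
  have x_sum: "x n t = (\<Sum>i<n. x (Suc i) t - x i t)" for n t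
    by (induction n) (simp_all add: x_def)
  have unif: "uniform_limit {0..T} x \<psi> sequentially" for T
  proof -
    obtain C l where C: "0 \<le> C" and
      bound: "\<And>n t. t \<in> {0..T} \<Longrightarrow> norm (x (Suc n) t - x n t) \<le> C * exp (l * t) * (1/2) ^ n"
      using contraction by metis
    have "uniform_limit {0..T} (\<lambda>n t. \<Sum>i<n. x (Suc i) t - x i t) \<psi> sequentially"
      unfolding \<psi>_def
    proof (rule Weierstrass_m_test)
      fix n t assume t: "t \<in> {0..T}"
      then have "l * t \<le> \<bar>l\<bar> * T"
        using mult_mono[of l "\<bar>l\<bar>" t T] by auto
      then have "C * exp (l * t) * (1/2) ^ n \<le> C * exp (\<bar>l\<bar> * T) * (1/2) ^ n"
        using C by (intro mult_right_mono mult_left_mono) auto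
      with bound[OF t, of n] show "norm (x (Suc n) t - x n t) \<le> C * exp (\<bar>l\<bar> * T) * (1/2) ^ n"
        by linarith
    qed (auto intro!: summable_mult summable_geometric)
    then show ?thesis by (simp add: x_sum[symmetric])
  qed
  have \<psi>_cont': "continuous_on {0..T} \<psi>" for T
    by (rule uniform_limit_theorem[OF _ unif]) (auto intro!: always_eventually x_cont')
  have \<psi>_cont: "continuous_on {0..} \<psi>"
  proof (rule continuous_on_eq_continuous_within[THEN iffD2], rule ballI)
    fix t :: real assume t: "t \<in> {0..}"
    have "continuous (at t within {0..t+1}) \<psi>"
      using \<psi>_cont'[of "t+1"] t by (auto simp: continuous_on_eq_continuous_within)
    moreover have "at t within {0..t+1} = at t within {0..}"
      by (rule at_within_nhd[of _ "{..<t+1}"]) auto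
    ultimately show "continuous (at t within {0..}) \<psi>" by simp
  qed
  have "\<psi> t = V \<psi> t" if t: "0 \<le> t" for t
  proof (rule LIMSEQ_unique)
    have "(\<lambda>n. x n t) \<longlonglongrightarrow> \<psi> t" using tendsto_uniform_limitI[OF unif[of t]] t by auto
    then show "(\<lambda>n. x (Suc n) t) \<longlonglongrightarrow> \<psi> t" by (rule LIMSEQ_Suc)
    obtain M where M: "\<And>s u v. s \<in> {0..t} \<Longrightarrow> norm (G s u - G s v) \<le> M * norm (u - v)"
      using lip by metis
    \<comment> \<open>At time t, \<open>V\<close> enlarges uniform distances on [0, t] by a factor
      of at most k - 1. A tolerance of e / k therefore yields e (k - 1) / k < e, and the added 1
      keeps k positive.\<close>
    define k where "k = volterra K (\<lambda>s. \<bar>M\<bar> + 1) t + 1"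
    have k: "0 < k" unfolding k_def using volterra_nonneg[of t "\<lambda>s. \<bar>M\<bar> + 1"] by auto
    show "(\<lambda>n. x (Suc n) t) \<longlonglongrightarrow> V \<psi> t"
    proof (rule tendstoI)
      fix e :: real assume e: "0 < e"
      have "\<forall>\<^sub>F n in sequentially. \<forall>s\<in>{0..t}. dist (x n s) (\<psi> s) < e / k"
        using unif[of t] e k by (auto simp: uniform_limit_iff)
      then show "\<forall>\<^sub>F n in sequentially. dist (x (Suc n) t) (V \<psi> t) < e"
      proof eventually_elim
        case (elim n)
        have "dist (x (Suc n) t) (V \<psi> t) = norm (volterra K (\<lambda>s. G s (x n s) - G s (\<psi> s)) t)"
          unfolding x_Suc V_def dist_norm by (simp add: volterra_diff G_cont x_cont \<psi>_cont)
        also have "\<dots> \<le> volterra K (\<lambda>s. (e / k) * (\<bar>M\<bar> + 1)) t"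
        proof (rule volterra_norm_le)
          fix s assume s: "s \<in> {0..t}"
          have "norm (G s (x n s) - G s (\<psi> s)) \<le> (\<bar>M\<bar> + 1) * norm (x n s - \<psi> s)"
            by (rule order_trans[OF M[OF s]]) (intro mult_right_mono, auto)
          also have "\<dots> \<le> (\<bar>M\<bar> + 1) * (e / k)"
            using elim s by (intro mult_left_mono) (auto simp: dist_norm intro: less_imp_le)
          finally show "norm (G s (x n s) - G s (\<psi> s)) \<le> (e / k) * (\<bar>M\<bar> + 1)" by (simp add: mult.commute)
        qed (auto intro!: continuous_intros G_cont x_cont \<psi>_cont)
        also have "\<dots> = (e / k) * (k - 1)" unfolding k_def by (simp only: volterra_cmult add_diff_cancel_right')
        also have "\<dots> < e" using e k by (simp add: field_simps)
        finally show ?case .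
      qed
    qed
  qed
  with \<psi>_cont show ?thesis using that unfolding V_def by blast
qed

section \<open>Components of complex convolutions and linear majorants\<close>

lemma volterra_Re:
  assumes "continuous_on {0..t} g"
  shows "Re (volterra K g t) = volterra K (\<lambda>s. Re (g s)) t"
  using integral_Re[OF integrable_conv[OF assms, unfolded set_integrable_def]]
  by (simp add: volterra_def set_lebesgue_integral_def mult.assoc)

lemma volterra_Im:
  assumes "continuous_on {0..t} g"
  shows "Im (volterra K g t) = volterra K (\<lambda>s. Im (g s)) t"
  using integral_Im[OF integrable_conv[OF assms, unfolded set_integrable_def]]
  by (simp add: volterra_def set_lebesgue_integral_def mult.assoc)

text \<open>The equation is first solved with |x| in place of x: its right-hand side is nonnegative,
  hence so is the solution, and the modulus disappears. Such solutions are the barriers of the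
  comparison arguments.\<close>

lemma volterra_affine_majorant:
  fixes a :: "real \<Rightarrow> real"
  assumes a: "continuous_on {0..} a" and a0: "\<And>t. 0 \<le> t \<Longrightarrow> 0 \<le> a t" and C: "0 \<le> C"
  obtains x where "continuous_on {0..} x" "\<And>t. 0 \<le> t \<Longrightarrow> 0 \<le> x t"
    "\<And>t. 0 \<le> t \<Longrightarrow> x t = volterra K (\<lambda>s. a s + C * x s) t"
proof -
  obtain x where x: "continuous_on {0..} x" "\<And>t. 0 \<le> t \<Longrightarrow> x t = volterra K (\<lambda>s. a s + C * \<bar>x s\<bar>) t"
  proof (rule volterra_lipschitz_existence[where G = "\<lambda>s u. a s + C * \<bar>u\<bar>"])
    show "\<exists>M. \<forall>s\<in>{0..T}. \<forall>u v. norm (a s + C * \<bar>u\<bar> - (a s + C * \<bar>v\<bar>)) \<le> M * norm (u - v)" for T :: real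
    proof (intro exI[of _ C] ballI allI)
      fix s u v :: real
      have "norm (a s + C * \<bar>u\<bar> - (a s + C * \<bar>v\<bar>)) = C * \<bar>\<bar>u\<bar> - \<bar>v\<bar>\<bar>"
        using C by (simp add: right_diff_distrib[symmetric] abs_mult)
      also have "\<dots> \<le> C * norm (u - v)" using C by (intro mult_left_mono) auto
      finally show "norm (a s + C * \<bar>u\<bar> - (a s + C * \<bar>v\<bar>)) \<le> C * norm (u - v)" .
    qed
  qed (auto intro!: continuous_intros a)
  have nonneg: "0 \<le> x t" if t: "0 \<le> t" for t
    unfolding x(2)[OF t]
  proof (rule volterra_nonneg)
    show "continuous_on {0..t} (\<lambda>s. a s + C * \<bar>x s\<bar>)"
      by (rule continuous_on_subset[of "{0..}"]) (auto intro!: continuous_intros a x(1))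
  qed (use a0 C in auto)
  have "x t = volterra K (\<lambda>s. a s + C * x s) t" if t: "0 \<le> t" for t
    unfolding x(2)[OF t] by (rule volterra_cong) (use nonneg in auto)
  with x(1) nonneg that show ?thesis by blast
qed

end

section \<open>The memory property of the kernel\<close>

locale resolvent_kernel = volterra_kernel +
  fixes L :: "real measure"
  assumes K_antimono: "antimono_on {0<..} K"
    and K_C1: "K C1_differentiable_on {0<..}"
    and resolvent: "resolvent_first_kind K L"
    and L_antimono: "nonincreasing_measure L"
begin

section \<open>Regularity of the resolvent measure\<close>

lemma sets_L [measurable_cong]: "sets L = sets borel"
  using resolvent by (simp add: resolvent_first_kind_def measure_on_Rplus_def)

lemma L_finite: "emeasure L {0..t} < \<infinity>"
  using resolvent by (cases "0 \<le> t") (auto simp: resolvent_first_kind_def locally_finite_on_Rplus_def)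

lemma L_nonneg: "AE s in L. 0 \<le> s"
proof -
  have "{..<0} \<in> null_sets L"
    using resolvent sets_L by (auto simp: resolvent_first_kind_def measure_on_Rplus_def null_sets_def)
  then have "AE s in L. s \<notin> {..<0}" by (rule AE_not_in)
  then show ?thesis by eventually_elim auto
qed

lemma L_Icc_antimono: "0 \<le> x \<Longrightarrow> 0 \<le> u \<Longrightarrow> u \<le> u' \<Longrightarrow> emeasure L {u'..u' + x} \<le> emeasure L {u..u + x}"
  using L_antimono by (auto simp: nonincreasing_measure_def monotone_on_def)

text \<open>For intervals of length 0, monotonicity says that every earlier point carries at least
  the mass of t. A positive atom at t would thus force arbitrarily many such masses into [0, t],
  which has finite measure. An atom at 0 remains possible.\<close>

lemma L_atom:
  assumes "0 < t"
  shows "emeasure L {t} = 0"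
proof (rule ccontr)
  assume "emeasure L {t} \<noteq> 0"
  moreover have fin: "emeasure L {t} \<le> emeasure L {0..t}"
    by (intro emeasure_mono) (use assms sets_L in auto)
  ultimately obtain a where a: "emeasure L {t} = ennreal a" "0 < a"
    using L_finite[of t] by (cases "emeasure L {t}") (auto simp: top_unique)
  obtain B where B: "emeasure L {0..t} = ennreal B" "0 \<le> B"
    using L_finite[of t] by (cases "emeasure L {0..t}") auto
  obtain n :: nat where n: "B < real n * a" using ex_less_of_nat_mult[OF a(2)] by blast
  obtain A where A: "finite A" "card A = n" "A \<subseteq> {0..t}"
    using infinite_arbitrarily_large[of "{0..t}" n] infinite_Icc[OF assms] by blast
  have "ennreal (real n * a) = (\<Sum>s\<in>A. ennreal a)"
    using A a by (simp add: ennreal_of_nat_eq_real_of_nat ennreal_mult')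
  also have "\<dots> \<le> (\<Sum>s\<in>A. emeasure L {s})"
  proof (rule sum_mono)
    fix s assume "s \<in> A"
    with A L_Icc_antimono[of 0 s t] show "ennreal a \<le> emeasure L {s}" by (auto simp: a(1)[symmetric])
  qed
  also have "\<dots> = emeasure L A"
    by (rule emeasure_eq_sum_singleton[symmetric]) (use A sets_L in auto)
  also have "\<dots> \<le> emeasure L {0..t}" by (intro emeasure_mono) (use A sets_L in auto)
  finally show False using n B a(2) by (simp add: ennreal_le_iff)
qed

lemma L_Ico_eq_Icc:
  assumes "a < b" "0 < b"
  shows "emeasure L {a..<b} = emeasure L {a..b}"
proof -
  have "emeasure L {a..b} = emeasure L ({a..<b} \<union> {b})"
    by (rule arg_cong[where f = "emeasure L"]) (use assms in auto)
  also have "\<dots> = emeasure L {a..<b}"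
    by (rule emeasure_Un_null_set) (use L_atom assms sets_L in \<open>auto simp: null_sets_def\<close>)
  finally show ?thesis ..
qed

lemma sigma_finite_L: "sigma_finite_measure L"
proof
  have [simp]: "space L = UNIV" using sets_eq_imp_space_eq[OF sets_L] by simp
  show "\<exists>A. countable A \<and> A \<subseteq> sets L \<and> \<Union>A = space L \<and> (\<forall>a\<in>A. emeasure L a \<noteq> \<infinity>)"
  proof (intro exI[of _ "insert {..<0} (range (\<lambda>n. {0..real n}))"] conjI)
    show "\<Union> (insert {..<0} (range (\<lambda>n. {0..real n}))) = space L"
      by (auto simp: not_less) (metis linorder_not_less real_arch_simple)
    have "emeasure L {..<0} = 0"
      using resolvent by (simp add: resolvent_first_kind_def measure_on_Rplus_def)
    then show "\<forall>a\<in>insert {..<0} (range (\<lambda>n. {0..real n})). emeasure L a \<noteq> \<infinity>"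
      using L_finite by (auto simp: less_top)
  qed (auto simp: sets_L)
qed

section \<open>The resolvent identity on the whole line\<close>

text \<open>Extension by 0 turns truncated convolutions into integrals over the whole line, ready
  for Tonelli.\<close>

definition Kplus :: "real \<Rightarrow> real" where "Kplus x = indicator {0<..} x * K x"

lemma K_continuous: "continuous_on {0<..} K"
  using C1_differentiable_imp_continuous_on[OF K_C1] .

lemma Kplus_measurable [measurable]: "Kplus \<in> borel_measurable borel"
proof -
  have "(\<lambda>x. indicator {0<..} x *\<^sub>R K x) \<in> borel_measurable borel"
    by (rule borel_measurable_continuous_on_indicator[OF _ K_continuous]) simp
  then show ?thesis by (simp add: Kplus_def[abs_def])
qed

lemma Kplus_nonneg [simp]: "0 \<le> Kplus x"
  using K_nonneg[of x] by (auto simp: Kplus_def split: split_indicator)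

text \<open>For t > 0 this is the resolvent equation, the point \<open>r = t\<close> being null for
  \<open>L\<close>; for t \<le> 0 the integrand vanishes on [0, \<infinity>), where \<open>L\<close>
  lives.\<close>

lemma nn_convolution_Kplus: "(\<integral>\<^sup>+r. ennreal (Kplus (t - r)) \<partial>L) = indicator {0<..} t"
proof (cases "0 < t")
  case True
  let ?f = "\<lambda>s. indicator {0..t} s *\<^sub>R K (t - s)"
  have int1: "(LINT s|L. ?f s) = 1"
    using resolvent True by (simp add: resolvent_first_kind_def measure_convolution_def set_lebesgue_integral_def)
  \<comment> \<open>A non-integrable function would have integral 0 instead of 1.\<close>
  then have int: "integrable L ?f" using not_integrable_integral_eq by fastforce
  have "{t} \<in> null_sets L" using L_atom[OF True] sets_L by (auto simp: null_sets_def)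
  then have "AE s in L. s \<notin> {t}" by (rule AE_not_in)
  with L_nonneg have eq: "AE s in L. Kplus (t - s) = ?f s"
    by eventually_elim (auto simp: Kplus_def split: split_indicator)
  have "(\<integral>\<^sup>+s. ennreal (Kplus (t - s)) \<partial>L) = (\<integral>\<^sup>+s. ennreal (?f s) \<partial>L)"
    by (rule nn_integral_cong_AE) (use eq in eventually_elim, simp)
  also have "\<dots> = ennreal (LINT s|L. ?f s)"
    by (rule nn_integral_eq_integral[OF int]) (use eq in eventually_elim, metis Kplus_nonneg)
  finally show ?thesis using int1 True by simp
next
  case False
  have "AE r in L. ennreal (Kplus (t - r)) = 0"
    using L_nonneg by eventually_elim (use False in \<open>auto simp: Kplus_def split: split_indicator\<close>)
  then have "(\<integral>\<^sup>+r. ennreal (Kplus (t - r)) \<partial>L) = (\<integral>\<^sup>+r. 0 \<partial>L)" by (rule nn_integral_cong_AE)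
  with False show ?thesis by simp
qed

text \<open>Fundamental theorem of calculus with \<open>D\<close> = -K', nonnegative because
  \<open>K\<close> is nonincreasing. As a function of r, the integral is a superposition of the
  steps r \<le> x with weights \<open>D x\<close>; extended-real values prepare for Tonelli.\<close>

lemma Kplus_layers:
  "\<exists>D \<in> borel_measurable borel. (\<forall>x. 0 \<le> D x) \<and> (\<forall>r h. 0 < r \<longrightarrow> r \<le> h \<longrightarrow>
    ennreal (K r) = ennreal (K h) + (\<integral>\<^sup>+x. ennreal (D x) * indicator {r..h} x \<partial>lborel))"
proof -
  obtain K' where K': "\<And>x. 0 < x \<Longrightarrow> (K has_real_derivative K' x) (at x)" "continuous_on {0<..} K'"
    using K_C1 by (auto simp: C1_differentiable_on_def has_real_derivative_iff_has_vector_derivative)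
  have K'_neg: "K' x \<le> 0" if "0 < x" for x
  proof -
    have "mono_on {0<..} (\<lambda>x. - K x)" using K_antimono by (auto simp: monotone_on_def)
    from mono_on_imp_deriv_nonneg[OF this DERIV_minus[OF K'(1)[OF that]]] that show ?thesis by (auto simp: interior_open)
  qed
  define D where "D x = indicator {0<..} x *\<^sub>R (- K' x)" for x
  have D_meas: "D \<in> borel_measurable borel" unfolding D_def[abs_def]
    by (rule borel_measurable_continuous_on_indicator) (auto intro!: continuous_intros K'(2))
  have "ennreal (K r) = ennreal (K h) + (\<integral>\<^sup>+x. ennreal (D x) * indicator {r..h} x \<partial>lborel)"
    if r: "0 < r" "r \<le> h" for r h
  proof -
    have "(\<integral>\<^sup>+x. ennreal (D x) * indicator {r..h} x \<partial>lborel) = ennreal (- K h - (- K r))"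
    proof (rule nn_integral_FTC_Icc[OF D_meas _ _ r(2)])
      fix x assume x: "x \<in> {r..h}"
      then show "0 \<le> D x" using r K'_neg[of x] by (simp add: D_def)
      show "((\<lambda>x. - K x) has_real_derivative D x) (at x)"
        using DERIV_minus[OF K'(1)[of x]] x r by (simp add: D_def)
    qed
    moreover have "K h \<le> K r" using K_antimono r by (auto simp: monotone_on_def)
    ultimately show ?thesis using K_nonneg[of h] r by (simp flip: ennreal_plus)
  qed
  moreover have "0 \<le> D x" for x using K'_neg[of x] by (auto simp: D_def split: split_indicator)
  ultimately show ?thesis using D_meas by blast
qed

text \<open>In the notation of the introduction, \<open>shifted_kernel\<close> is \<open>k\<close>, \<open>shifted_head\<close> is \<open>k * L\<close>,
  and \<open>shifted_tail\<close> is the integral that is subtracted from 1 there.\<close>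

definition shifted_tail :: "real \<Rightarrow> real \<Rightarrow> ennreal" where
  "shifted_tail h u = (\<integral>\<^sup>+s. indicator {u..} s * ennreal (Kplus (u + h - s)) \<partial>L)"

text \<open>Writing the nonincreasing kernel as a superposition of indicators of intervals reduces the
  claim to the intervals on which the measure is assumed to be nonincreasing.\<close>

lemma shifted_tail_antimono:
  assumes "0 < h" "0 \<le> u" "u \<le> u'"
  shows "shifted_tail h u' \<le> shifted_tail h u"
proof -
  obtain D where D[measurable]: "D \<in> borel_measurable borel" and D0: "\<And>x. 0 \<le> D x" and
    layers: "\<And>r h. 0 < r \<Longrightarrow> r \<le> h \<Longrightarrow> ennreal (K r) = ennreal (K h) + (\<integral>\<^sup>+x. ennreal (D x) * indicator {r..h} x \<partial>lborel)"
    using Kplus_layers by blast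
  interpret L: sigma_finite_measure L by (rule sigma_finite_L)
  interpret pair_sigma_finite lborel L ..
  \<comment> \<open>Tonelli turns the tail into a mixture of masses of closed intervals, one for
    each layer x. The right endpoint stays in the form \<open>u + h - x + x\<close> so that
    monotonicity of \<open>L\<close> on intervals of length x applies as stated.\<close>
  have expand: "shifted_tail h u = ennreal (K h) * emeasure L {u..u + h}
      + (\<integral>\<^sup>+x. (if 0 < x \<and> x \<le> h then ennreal (D x) * emeasure L {u + h - x..u + h - x + x} else 0) \<partial>lborel)"
    if u: "0 \<le> u" for u
  proof -
    let ?g = "\<lambda>s x. if u \<le> s \<and> s < u + h \<and> u + h - s \<le> x \<and> x \<le> h then ennreal (D x) else 0"
    have outer: "indicator {u..} s * ennreal (Kplus (u + h - s))
        = ennreal (K h) * indicator {u..<u+h} s + (\<integral>\<^sup>+x. ?g s x \<partial>lborel)" for s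
    proof (cases "u \<le> s \<and> s < u + h")
      case True
      then have "(\<integral>\<^sup>+x. ?g s x \<partial>lborel) = (\<integral>\<^sup>+x. ennreal (D x) * indicator {u + h - s..h} x \<partial>lborel)"
        by (intro nn_integral_cong) (auto split: split_indicator)
      with True layers[of "u + h - s" h] show ?thesis by (simp add: Kplus_def)
    next
      case False
      then have "?g s x = 0" for x by auto
      then have "(\<integral>\<^sup>+x. ?g s x \<partial>lborel) = 0" by simp
      with False show ?thesis by (auto simp: Kplus_def split: split_indicator)
    qed
    \<comment> \<open>For 0 < x \<le> h the conditions on s reduce to the interval [u + h - x, u +
      h), which has length x and lies in [u, \<infinity>); its right end is not an atom.\<close>
    have inner: "(\<integral>\<^sup>+s. ?g s x \<partial>L) = (if 0 < x \<and> x \<le> h then ennreal (D x) * emeasure L {u + h - x..u + h - x + x} else 0)" for x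
    proof (cases "0 < x \<and> x \<le> h")
      case True
      then have "(\<integral>\<^sup>+s. ?g s x \<partial>L) = (\<integral>\<^sup>+s. ennreal (D x) * indicator {u + h - x..<u + h} s \<partial>L)"
        by (intro nn_integral_cong) (auto split: split_indicator)
      also have "\<dots> = ennreal (D x) * emeasure L {u + h - x..u + h}"
        using assms(1) u True by (subst nn_integral_cmult_indicator) (auto simp: sets_L L_Ico_eq_Icc)
      finally show ?thesis using True by simp
    next
      case False
      then have "?g s x = 0" for s by auto
      then have "(\<integral>\<^sup>+s. ?g s x \<partial>L) = 0" by simp
      with False show ?thesis by auto
    qed
    have "shifted_tail h u = (\<integral>\<^sup>+s. ennreal (K h) * indicator {u..<u+h} s + (\<integral>\<^sup>+x. ?g s x \<partial>lborel) \<partial>L)"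
      unfolding shifted_tail_def by (intro nn_integral_cong outer)
    also have "\<dots> = (\<integral>\<^sup>+s. ennreal (K h) * indicator {u..<u+h} s \<partial>L) + (\<integral>\<^sup>+s. (\<integral>\<^sup>+x. ?g s x \<partial>lborel) \<partial>L)"
      by (rule nn_integral_add) measurable
    also have "(\<integral>\<^sup>+s. ennreal (K h) * indicator {u..<u+h} s \<partial>L) = ennreal (K h) * emeasure L {u..u+h}"
      using assms(1) u by (subst nn_integral_cmult_indicator) (auto simp: sets_L L_Ico_eq_Icc)
    also have "(\<integral>\<^sup>+s. (\<integral>\<^sup>+x. ?g s x \<partial>lborel) \<partial>L) = (\<integral>\<^sup>+x. (\<integral>\<^sup>+s. ?g s x \<partial>L) \<partial>lborel)"
      by (rule Fubini') measurable
    also have "\<dots> = (\<integral>\<^sup>+x. (if 0 < x \<and> x \<le> h then ennreal (D x) * emeasure L {u + h - x..u + h - x + x} else 0) \<partial>lborel)"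
      by (intro nn_integral_cong inner)
    finally show ?thesis .
  qed
  show ?thesis
    unfolding expand[OF assms(2)] expand[OF order_trans[OF assms(2,3)]]
  proof (intro add_mono mult_left_mono nn_integral_mono)
    show "emeasure L {u'..u' + h} \<le> emeasure L {u..u + h}"
      using assms by (intro L_Icc_antimono) auto
    fix x
    show "(if 0 < x \<and> x \<le> h then ennreal (D x) * emeasure L {u' + h - x..u' + h - x + x} else 0)
       \<le> (if 0 < x \<and> x \<le> h then ennreal (D x) * emeasure L {u + h - x..u + h - x + x} else 0)"
      using assms L_Icc_antimono[of x "u + h - x" "u' + h - x"] by (auto intro!: mult_left_mono)
  qed auto
qed

section \<open>The resolvent identity split at the shift\<close>

definition shifted_kernel :: "real \<Rightarrow> real \<Rightarrow> real" where
  "shifted_kernel h v = indicator {0<..} v * Kplus (v + h)"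

definition shifted_head :: "real \<Rightarrow> real \<Rightarrow> ennreal" where
  "shifted_head h u = (\<integral>\<^sup>+s. ennreal (shifted_kernel h (u - s)) \<partial>L)"

lemma shifted_kernel_measurable [measurable]: "shifted_kernel h \<in> borel_measurable borel"
  unfolding shifted_kernel_def[abs_def] by measurable

lemma shifted_kernel_nonneg [simp]: "0 \<le> shifted_kernel h v"
  by (simp add: shifted_kernel_def)

text \<open>The identity \<open>K * L = 1\<close> at time u + h, split at u: the points s < u form
  the head, the points s \<ge> u the tail.\<close>

lemma shifted_head_plus_tail:
  assumes "0 < h" "0 \<le> u"
  shows "shifted_head h u + shifted_tail h u = 1"
proof -
  have "shifted_head h u + shifted_tail h u
      = (\<integral>\<^sup>+s. ennreal (shifted_kernel h (u - s)) + indicator {u..} s * ennreal (Kplus (u + h - s)) \<partial>L)"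
    unfolding shifted_head_def shifted_tail_def by (rule nn_integral_add[symmetric]) measurable
  also have "\<dots> = (\<integral>\<^sup>+s. ennreal (Kplus (u + h - s)) \<partial>L)"
    by (intro nn_integral_cong) (auto simp: shifted_kernel_def algebra_simps split: split_indicator)
  finally show ?thesis using assms by (simp add: nn_convolution_Kplus)
qed

lemma shifted_head_neg: "u \<le> 0 \<Longrightarrow> shifted_head h u = 0"
proof -
  assume u: "u \<le> 0"
  have "AE s in L. ennreal (shifted_kernel h (u - s)) = 0"
    using L_nonneg by eventually_elim (use u in \<open>auto simp: shifted_kernel_def split: split_indicator\<close>)
  then have "shifted_head h u = (\<integral>\<^sup>+s. 0 \<partial>L)" unfolding shifted_head_def by (rule nn_integral_cong_AE)
  then show ?thesis by simp
qed

lemma shifted_head_le_1: "0 < h \<Longrightarrow> shifted_head h u \<le> 1"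
proof (cases "0 \<le> u")
  case True
  assume "0 < h"
  from shifted_head_plus_tail[OF this True] show ?thesis by (metis le_iff_add)
qed (auto simp: shifted_head_neg)

text \<open>The head is 1 minus the nonincreasing tail, and the tail is finite, so it can be
  cancelled in the extended reals. For u < 0 the head is 0.\<close>

lemma shifted_head_mono:
  assumes "0 < h" "u \<le> u'"
  shows "shifted_head h u \<le> shifted_head h u'"
proof (cases "0 \<le> u")
  case True
  with assms have eq: "shifted_head h u + shifted_tail h u = shifted_head h u' + shifted_tail h u'"
    by (simp add: shifted_head_plus_tail)
  have fin: "shifted_tail h u \<noteq> top"
    using shifted_head_plus_tail[OF assms(1) True] by (metis ennreal_add_eq_top ennreal_one_neq_top)
  have "shifted_head h u + shifted_tail h u \<le> shifted_head h u' + shifted_tail h u"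
    unfolding eq by (intro add_left_mono shifted_tail_antimono assms True)
  then show ?thesis using fin by (simp add: ennreal_add_left_cancel_le add.commute)
qed (simp add: shifted_head_neg)

section \<open>The primitive of the shifted kernel\<close>

text \<open>For x \<ge> 0 this is \<open>1 * k\<close> at x, the integral of \<open>K\<close> over
  [h, x + h].\<close>

definition shifted_primitive :: "real \<Rightarrow> real \<Rightarrow> ennreal" where
  "shifted_primitive h x = (\<integral>\<^sup>+s. ennreal (shifted_kernel h s) * indicator {s<..} x \<partial>lborel)"

lemma shifted_head_measurable [measurable]: "shifted_head h \<in> borel_measurable borel"
proof -
  interpret L: sigma_finite_measure L by (rule sigma_finite_L)
  show ?thesis unfolding shifted_head_def[abs_def] by measurable
qed

text \<open>Associativity of convolution: (k * L) * K = k * (L * K) = k * 1. All factors are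
  nonnegative, so Tonelli permits the exchanges.\<close>

lemma shifted_head_convolution:
  "(\<integral>\<^sup>+s. shifted_head h (t - s) * ennreal (Kplus (s - q)) \<partial>lborel) = shifted_primitive h (t - q)"
proof -
  interpret L: sigma_finite_measure L by (rule sigma_finite_L)
  interpret pair_sigma_finite lborel L ..
  have "(\<integral>\<^sup>+s. shifted_head h (t - s) * ennreal (Kplus (s - q)) \<partial>lborel)
      = (\<integral>\<^sup>+s. \<integral>\<^sup>+r. ennreal (shifted_kernel h (t - s - r)) * ennreal (Kplus (s - q)) \<partial>L \<partial>lborel)"
    unfolding shifted_head_def by (intro nn_integral_cong nn_integral_multc[symmetric]) measurable
  also have "\<dots> = (\<integral>\<^sup>+r. \<integral>\<^sup>+s. ennreal (shifted_kernel h (t - s - r)) * ennreal (Kplus (s - q)) \<partial>lborel \<partial>L)"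
    by (rule Fubini'[symmetric]) measurable
  also have "\<dots> = (\<integral>\<^sup>+r. \<integral>\<^sup>+s. ennreal (shifted_kernel h (t - s)) * ennreal (Kplus ((s - q) - r)) \<partial>lborel \<partial>L)"
  proof (rule nn_integral_cong)
    \<comment> \<open>Translating s by r moves the variable of \<open>L\<close> from the shifted
      kernel to \<open>Kplus\<close>.\<close>
    fix r
    have "(\<integral>\<^sup>+s. ennreal (shifted_kernel h (t - s - r)) * ennreal (Kplus (s - q)) \<partial>lborel)
        = ennreal \<bar>1\<bar> * (\<integral>\<^sup>+s. ennreal (shifted_kernel h (t - (- r + 1 * s) - r)) * ennreal (Kplus ((- r + 1 * s) - q)) \<partial>lborel)"
      by (rule nn_integral_real_affine) simp_all
    then show "(\<integral>\<^sup>+s. ennreal (shifted_kernel h (t - s - r)) * ennreal (Kplus (s - q)) \<partial>lborel)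
        = (\<integral>\<^sup>+s. ennreal (shifted_kernel h (t - s)) * ennreal (Kplus ((s - q) - r)) \<partial>lborel)"
      by (simp add: algebra_simps)
  qed
  also have "\<dots> = (\<integral>\<^sup>+s. \<integral>\<^sup>+r. ennreal (shifted_kernel h (t - s)) * ennreal (Kplus ((s - q) - r)) \<partial>L \<partial>lborel)"
    by (rule Fubini') measurable
  also have "\<dots> = (\<integral>\<^sup>+s. ennreal (shifted_kernel h (t - s)) * indicator {0<..} (s - q) \<partial>lborel)"
    by (intro nn_integral_cong) (simp add: nn_integral_cmult nn_convolution_Kplus)
  also have "\<dots> = ennreal \<bar>-1\<bar> * (\<integral>\<^sup>+s. ennreal (shifted_kernel h (t - (t + -1 * s))) * indicator {0<..} ((t + -1 * s) - q) \<partial>lborel)"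
    by (rule nn_integral_real_affine) simp_all
  also have "\<dots> = shifted_primitive h (t - q)"
    unfolding shifted_primitive_def
    by (simp, intro nn_integral_cong) (auto split: split_indicator)
  finally show ?thesis .
qed

definition shifted_integral :: "real \<Rightarrow> real \<Rightarrow> real" where
  "shifted_integral h x = enn2real (shifted_primitive h x)"

text \<open>\<open>K\<close> may be singular at 0, so the antiderivative starts at h / 2: it is then
  differentiable on a neighbourhood of [h, \<infinity>), the range in which the shifted kernel
  evaluates \<open>K\<close>.\<close>

lemma shifted_primitive_antiderivative:
  assumes h: "0 < h"
  obtains A where "\<And>x. h / 2 < x \<Longrightarrow> (A has_real_derivative K x) (at x)"
    "\<And>x. 0 \<le> x \<Longrightarrow> shifted_primitive h x = ennreal (A (x + h) - A h)"
proof -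
  define A where "A x = integral {h/2..x} K" for x
  have A: "(A has_real_derivative K x) (at x)" if x: "h / 2 < x" for x
  proof -
    have "continuous_on {h/2..x+1} K" by (rule continuous_on_subset[OF K_continuous]) (use h in auto)
    then have "(A has_real_derivative K x) (at x within {h/2..x+1})"
      unfolding A_def[abs_def] by (rule integral_has_real_derivative) (use x in auto)
    moreover have "at x within {h/2..x+1} = at x"
      by (rule at_within_interior) (use x in auto)
    ultimately show ?thesis by simp
  qed
  have "shifted_primitive h x = ennreal (A (x + h) - A h)" if x: "0 \<le> x" for x
  proof -
    have "shifted_primitive h x = (\<integral>\<^sup>+s. ennreal (Kplus (s + h)) * indicator {0..x} s \<partial>lborel)"
      unfolding shifted_primitive_def
    proof (rule nn_integral_cong_AE)
      show "AE s in lborel. ennreal (shifted_kernel h s) * indicator {s<..} x = ennreal (Kplus (s + h)) * indicator {0..x} s"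
        using AE_lborel_singleton[of 0] AE_lborel_singleton[of x]
        by eventually_elim (auto simp: shifted_kernel_def split: split_indicator)
    qed
    also have "\<dots> = ennreal (A (x + h) - A (0 + h))"
    proof (rule nn_integral_FTC_Icc)
      fix s assume "s \<in> {0..x}"
      then have s: "0 \<le> s" "s \<le> x" by auto
      show "((\<lambda>s. A (s + h)) has_real_derivative Kplus (s + h)) (at s)"
        using DERIV_shift[of A "K (s + h)" s h] A[of "s + h"] s h by (simp add: Kplus_def)
    qed (use x in \<open>auto\<close>)
    finally show ?thesis by simp
  qed
  with A that show ?thesis by blast
qed

lemma shifted_primitive_neg: "x \<le> 0 \<Longrightarrow> shifted_primitive h x = 0"
proof -
  assume "x \<le> 0"
  then have "(\<lambda>s. ennreal (shifted_kernel h s) * indicator {s<..} x) = (\<lambda>s. 0)"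
    by (auto simp: fun_eq_iff shifted_kernel_def split: split_indicator)
  then show ?thesis by (simp add: shifted_primitive_def)
qed

text \<open>On [h, \<infinity>) the kernel lies between 0 and \<open>K h\<close>, whence the
  Lipschitz constant. The function is 0 to the left of 0 and may have a kink there, so the
  derivative is taken at z > 0.\<close>

lemma shifted_integral_facts:
  assumes h: "0 < h"
  shows shifted_primitive_eq: "shifted_primitive h x = ennreal (shifted_integral h x)"
    and shifted_integral_lipschitz: "\<bar>shifted_integral h x - shifted_integral h y\<bar> \<le> K h * \<bar>x - y\<bar>"
    and shifted_integral_deriv: "0 < z \<Longrightarrow> (shifted_integral h has_real_derivative K (z + h)) (at z)"
proof -
  obtain A where A: "\<And>x. h / 2 < x \<Longrightarrow> (A has_real_derivative K x) (at x)"
    and prim: "\<And>x. 0 \<le> x \<Longrightarrow> shifted_primitive h x = ennreal (A (x + h) - A h)"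
    using shifted_primitive_antiderivative[OF h] by metis
  have A_lip: "0 \<le> A b - A a \<and> A b - A a \<le> K h * (b - a)" if "h \<le> a" "a \<le> b" for a b
  proof (cases "a = b")
    case False
    then have "\<exists>z. a < z \<and> z < b \<and> A b - A a = (b - a) * K z"
      by (intro MVT2) (use that h A in auto)
    then obtain z where z: "a < z" "z < b" "A b - A a = (b - a) * K z" by blast
    then have "K z \<le> K h" "0 \<le> K z" using K_antimono K_nonneg[of z] that h by (auto simp: monotone_on_def)
    with z show ?thesis by (simp add: mult.commute mult_left_mono)
  qed simp
  have eq: "shifted_integral h x = A (max x 0 + h) - A h" for x
    using prim[of x] shifted_primitive_neg[of x h] A_lip[of h "x + h"] h
    by (cases "0 \<le> x") (auto simp: shifted_integral_def max_def)
  show "shifted_primitive h x = ennreal (shifted_integral h x)" for x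
    using prim[of x] shifted_primitive_neg[of x h] unfolding eq by (cases "0 \<le> x") (auto simp: max_def)
  show "\<bar>shifted_integral h x - shifted_integral h y\<bar> \<le> K h * \<bar>x - y\<bar>" for x y
  proof -
    have *: "\<bar>shifted_integral h x - shifted_integral h y\<bar> \<le> K h * \<bar>x - y\<bar>" if "y \<le> x" for x y
    proof -
      have "\<bar>shifted_integral h x - shifted_integral h y\<bar> \<le> K h * (max x 0 - max y 0)"
        using A_lip[of "max y 0 + h" "max x 0 + h"] that by (auto simp: eq)
      also have "\<dots> \<le> K h * \<bar>x - y\<bar>" using K_nonneg[OF h] that by (intro mult_left_mono) auto
      finally show ?thesis .
    qed
    show ?thesis using *[of x y] *[of y x] by (cases "x \<le> y") (auto simp: abs_minus_commute)
  qed
  show "(shifted_integral h has_real_derivative K (z + h)) (at z)" if z: "0 < z" for z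
  proof (rule DERIV_cong_ev[THEN iffD1])
    show "\<forall>\<^sub>F x in nhds z. A (x + h) - A h = shifted_integral h x"
      using eventually_nhds_in_open[of "{0<..}" z] z
      by (auto elim!: eventually_mono simp: eq max_def)
    have "((\<lambda>x. A (x + h)) has_real_derivative K (z + h)) (at z)"
      using DERIV_shift[of A "K (z + h)" z h] A[of "z + h"] z h by auto
    from DERIV_diff[OF this DERIV_const[of "A h"]]
    show "((\<lambda>x. A (x + h) - A h) has_real_derivative K (z + h)) (at z)" by simp
  qed auto
qed

text \<open>In the proof \<open>g0\<close> is g cut off after \<tau>, \<open>d\<close> is K * g0,
  \<open>n\<close> is k * L, and \<open>\<Psi>\<close> is 1 * (k * g0), so that \<Psi> = n * d.
  Since \<Psi> is largest at \<tau> among all t \<le> \<tau>, its left difference quotients at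
  \<tau> are nonnegative, and they converge to the integral claimed.\<close>

lemma future_of_nonneg_past:
  fixes g :: "real \<Rightarrow> real"
  assumes g: "continuous_on {0..} g" and \<tau>: "0 \<le> \<tau>" and h: "0 < h"
    and past: "\<And>t. 0 \<le> t \<Longrightarrow> t \<le> \<tau> \<Longrightarrow> 0 \<le> volterra K g t"
  shows "0 \<le> (LINT s:{0..\<tau>}|lborel. K (\<tau> + h - s) *\<^sub>R g s)"
proof -
  define g0 where "g0 q = indicator {0..\<tau>} q *\<^sub>R g q" for q
  have g_sub: "continuous_on {0..t} g" for t by (rule continuous_on_subset[OF g]) auto
  have g0_int: "integrable lborel g0"
    using borel_integrable_atLeastAtMost'[OF g_sub[of \<tau>]] by (simp add: set_integrable_def g0_def[abs_def])
  then have g0_meas [measurable]: "g0 \<in> borel_measurable borel" by auto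
  have K_h: "0 \<le> K h" using K_nonneg[OF h] .
  have p_meas [measurable]: "shifted_integral h \<in> borel_measurable borel"
  proof (intro borel_measurable_continuous_onI lipschitz_on_continuous_on lipschitz_onI)
    show "dist (shifted_integral h x) (shifted_integral h y) \<le> K h * dist x y" for x y
      using shifted_integral_lipschitz[OF h] by (simp add: dist_real_def)
  qed fact
  have p_nonneg: "0 \<le> shifted_integral h x" for x by (simp add: shifted_integral_def)
  define n where "n u = enn2real (shifted_head h u)" for u
  have n: "ennreal (n u) = shifted_head h u" for u
    using le_less_trans[OF shifted_head_le_1[OF h, of u]] by (simp add: n_def less_top)
  have n_meas [measurable]: "n \<in> borel_measurable borel" unfolding n_def[abs_def] by measurable
  have n_nonneg: "0 \<le> n u" for u by (simp add: n_def)
  have n_mono: "n u \<le> n u'" if "u \<le> u'" for u u'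
    using shifted_head_mono[OF h that] n_nonneg[of u'] unfolding n[symmetric] by simp
  define d where "d s = (LINT q|lborel. Kplus (s - q) * g0 q)" for s
  define \<Psi> where "\<Psi> t = (LINT q|lborel. shifted_integral h (t - q) * g0 q)" for t
  have \<Psi>_int: "integrable lborel (\<lambda>q. shifted_integral h (t - q) * g0 q)" for t
  proof (rule Bochner_Integration.integrable_bound)
    \<comment> \<open>The primitive vanishes at 0 and has Lipschitz constant \<open>K h\<close>;
      moreover |t - q| \<le> |t| + \<tau> for q in [0, \<tau>].\<close>
    show "integrable lborel (\<lambda>q. (K h * (\<bar>t\<bar> + \<tau>)) * g0 q)" using g0_int by simp
    show "AE q in lborel. norm (shifted_integral h (t - q) * g0 q) \<le> norm ((K h * (\<bar>t\<bar> + \<tau>)) * g0 q)"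
    proof (rule AE_I2)
      fix q
      show "norm (shifted_integral h (t - q) * g0 q) \<le> norm ((K h * (\<bar>t\<bar> + \<tau>)) * g0 q)"
      proof (cases "q \<in> {0..\<tau>}")
        case True
        have "\<bar>shifted_integral h (t - q)\<bar> \<le> K h * \<bar>t - q\<bar>"
          using shifted_integral_lipschitz[OF h, of "t - q" 0] by (simp add: shifted_integral_def shifted_primitive_neg)
        also have "\<dots> \<le> K h * (\<bar>t\<bar> + \<tau>)" using True K_h by (intro mult_left_mono) auto
        finally show ?thesis using K_h \<tau> by (simp add: abs_mult mult_right_mono)
      qed (simp add: g0_def)
    qed
  qed measurable
  have rep: "\<Psi> t = (LINT s|lborel. n (t - s) * d s)" "integrable lborel (\<lambda>s. n (t - s) * d s)" for t
  proof -
    let ?f = "\<lambda>s q. n (t - s) * (Kplus (s - q) * g0 q)"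
    have inner: "(\<integral>\<^sup>+s. ennreal (n (t - s) * Kplus (s - q)) \<partial>lborel) = ennreal (shifted_integral h (t - q))" for q
      using shifted_head_convolution[of h t q] shifted_primitive_eq[OF h, of "t - q"]
      by (simp add: n[symmetric] ennreal_mult' n_nonneg)
    \<comment> \<open>Fubini needs absolute integrability: integrating in s first collapses n and
      \<open>Kplus\<close> to the primitive, whose product with \<open>g0\<close> is already known
      to be integrable.\<close>
    have "integrable (lborel \<Otimes>\<^sub>M lborel) (\<lambda>(s, q). ?f s q)"
    proof (rule integrableI_bounded)
      have "(\<integral>\<^sup>+x. ennreal (norm (case x of (s, q) \<Rightarrow> ?f s q)) \<partial>(lborel \<Otimes>\<^sub>M lborel))
          = (\<integral>\<^sup>+q. \<integral>\<^sup>+s. ennreal (norm (?f s q)) \<partial>lborel \<partial>lborel)"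
        by (subst lborel_pair.nn_integral_snd[symmetric]) auto
      also have "\<dots> = (\<integral>\<^sup>+q. ennreal (norm (shifted_integral h (t - q) * g0 q)) \<partial>lborel)"
      proof (rule nn_integral_cong)
        fix q
        have "(\<integral>\<^sup>+s. ennreal (norm (?f s q)) \<partial>lborel) = (\<integral>\<^sup>+s. ennreal (n (t - s) * Kplus (s - q)) * ennreal \<bar>g0 q\<bar> \<partial>lborel)"
          by (intro nn_integral_cong) (simp add: abs_mult n_nonneg ennreal_mult'[symmetric] mult.assoc)
        also have "\<dots> = ennreal (shifted_integral h (t - q)) * ennreal \<bar>g0 q\<bar>"
          by (subst nn_integral_multc) (auto simp: inner)
        finally show "(\<integral>\<^sup>+s. ennreal (norm (?f s q)) \<partial>lborel) = ennreal (norm (shifted_integral h (t - q) * g0 q))"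
          by (simp add: abs_mult p_nonneg ennreal_mult')
      qed
      also have "\<dots> < \<infinity>" using \<Psi>_int[of t] unfolding integrable_iff_bounded by blast
      finally show "(\<integral>\<^sup>+x. ennreal (norm (case x of (s, q) \<Rightarrow> ?f s q)) \<partial>(lborel \<Otimes>\<^sub>M lborel)) < \<infinity>" .
    qed measurable
    note int = this
    have inner_d: "(LINT q|lborel. ?f s q) = n (t - s) * d s" for s by (simp add: d_def)
    show "integrable lborel (\<lambda>s. n (t - s) * d s)"
      using lborel_pair.integrable_fst'[OF int] by (simp add: d_def)
    have "(LINT s|lborel. n (t - s) * d s) = (LINT q|lborel. LINT s|lborel. ?f s q)"
      unfolding inner_d[symmetric] by (rule lborel_pair.Fubini_integral[OF int, symmetric])
    also have "\<dots> = \<Psi> t"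
      unfolding \<Psi>_def
    proof (rule Bochner_Integration.integral_cong)
      fix q
      have "(LINT s|lborel. ?f s q) = (LINT s|lborel. n (t - s) * Kplus (s - q)) * g0 q"
        by (simp add: mult.assoc[symmetric])
      also have "(LINT s|lborel. n (t - s) * Kplus (s - q)) = shifted_integral h (t - q)"
        by (subst integral_eq_nn_integral) (auto simp: inner n_nonneg p_nonneg)
      finally show "(LINT s|lborel. ?f s q) = shifted_integral h (t - q) * g0 q" .
    qed simp
    finally show "\<Psi> t = (LINT s|lborel. n (t - s) * d s)" ..
  qed
  have d_nonneg: "0 \<le> d s" if s: "s \<le> \<tau>" for s
  proof (cases "0 \<le> s")
    case True
    have "d s = volterra K g s"
      unfolding d_def volterra_def set_lebesgue_integral_def
    proof (rule integral_cong_AE)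
      show "(\<lambda>q. indicator {0..s} q *\<^sub>R K (s - q) *\<^sub>R g q) \<in> borel_measurable lborel"
        using integrable_conv[OF g_sub[of s]] by (auto simp: set_integrable_def)
      show "AE q in lborel. Kplus (s - q) * g0 q = indicator {0..s} q *\<^sub>R K (s - q) *\<^sub>R g q"
        using AE_lborel_singleton[of s]
        by eventually_elim (use s in \<open>auto simp: Kplus_def g0_def split: split_indicator\<close>)
    qed measurable
    with past[OF True s] show ?thesis by simp
  next
    case False
    then have "(\<lambda>q. Kplus (s - q) * g0 q) = (\<lambda>q. 0)"
      by (auto simp: fun_eq_iff Kplus_def g0_def split: split_indicator)
    then show ?thesis by (simp add: d_def)
  qed
  have \<Psi>_mono: "\<Psi> t \<le> \<Psi> \<tau>" if t: "t \<le> \<tau>" for t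
    unfolding rep(1)
  proof (rule integral_mono[OF rep(2) rep(2)])
    fix s
    \<comment> \<open>Up to \<tau>, \<open>d\<close> is nonnegative and \<open>n\<close> is
      nondecreasing; beyond \<tau> both values of \<open>n\<close> are 0, so the sign of
      \<open>d\<close> there does not matter.\<close>
    show "n (t - s) * d s \<le> n (\<tau> - s) * d s"
    proof (cases "s \<le> \<tau>")
      case True
      then show ?thesis using t by (intro mult_right_mono n_mono d_nonneg) auto
    next
      case False
      then show ?thesis using t by (simp add: n_def shifted_head_neg)
    qed
  qed
  \<comment> \<open>Steps to the left, because the comparison of \<open>\<Psi>\<close> with its
    value at \<tau> is available for earlier times.\<close>
  let ?e = "\<lambda>k. - inverse (real (Suc k))"
  let ?D = "\<lambda>k q. (shifted_integral h (\<tau> + ?e k - q) - shifted_integral h (\<tau> - q)) / ?e k"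
  have "(\<lambda>k. LINT q|lborel. ?D k q * g0 q)
      \<longlonglongrightarrow> (LINT q|lborel. Kplus (\<tau> + h - q) * g0 q)"
  proof (rule integral_dominated_convergence[where w = "\<lambda>q. K h * \<bar>g0 q\<bar>"])
    show "integrable lborel (\<lambda>q. K h * \<bar>g0 q\<bar>)" using g0_int by simp
    \<comment> \<open>At q = \<tau> the primitive is evaluated at its kink 0; beyond \<tau> the
      factor \<open>g0\<close> vanishes.\<close>
    show "AE q in lborel. (\<lambda>k. ?D k q * g0 q)
        \<longlonglongrightarrow> Kplus (\<tau> + h - q) * g0 q"
      using AE_lborel_singleton[of \<tau>]
    proof eventually_elim
      fix q assume "q \<noteq> \<tau>"
      show "(\<lambda>k. ?D k q * g0 q)
        \<longlonglongrightarrow> Kplus (\<tau> + h - q) * g0 q"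
      proof (cases "q < \<tau>")
        case True
        have "((\<lambda>k. (shifted_integral h (\<tau> + k - q) - shifted_integral h (\<tau> - q)) / k) \<longlongrightarrow> Kplus (\<tau> + h - q)) (at 0)"
        proof -
          have "\<tau> - q + k = \<tau> + k - q" for k by simp
          moreover have "Kplus (\<tau> + h - q) = K (\<tau> + h - q)" using True h by (simp add: Kplus_def)
          ultimately show ?thesis
            using shifted_integral_deriv[OF h, of "\<tau> - q"] True by (simp only: DERIV_def diff_gt_0_iff_gt)
        qed
        moreover have "filterlim ?e (at 0) sequentially"
          using tendsto_minus[OF LIMSEQ_inverse_real_of_nat] by (intro filterlim_atI) auto
        ultimately have "(\<lambda>k. ?D k q) \<longlonglongrightarrow> Kplus (\<tau> + h - q)"
          by (rule filterlim_compose)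
        then show ?thesis by (rule tendsto_mult_right)
      qed (use \<open>q \<noteq> \<tau>\<close> in \<open>simp add: g0_def\<close>)
    qed
    show "AE q in lborel. norm (?D k q * g0 q) \<le> K h * \<bar>g0 q\<bar>" for k
    proof (rule AE_I2)
      fix q
      have "\<bar>shifted_integral h (\<tau> + ?e k - q) - shifted_integral h (\<tau> - q)\<bar> / inverse (real (Suc k)) \<le> K h"
        using shifted_integral_lipschitz[OF h, of "\<tau> + ?e k - q" "\<tau> - q"]
        by (subst pos_divide_le_eq) auto
      then show "norm (?D k q * g0 q) \<le> K h * \<bar>g0 q\<bar>"
        by (auto dest: mult_right_mono[OF _ abs_ge_zero[of "g0 q"]] simp: abs_mult)
    qed
  qed measurable
  moreover have "(LINT q|lborel. ?D k q * g0 q) \<ge> 0" for k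
  proof -
    have "(LINT q|lborel. ?D k q * g0 q)
        = (LINT q|lborel. (- real (Suc k)) * (shifted_integral h (\<tau> + ?e k - q) * g0 q - shifted_integral h (\<tau> - q) * g0 q))"
      by (intro Bochner_Integration.integral_cong) (auto simp: field_simps)
    also have "\<dots> = (- real (Suc k)) * (\<Psi> (\<tau> + ?e k) - \<Psi> \<tau>)"
      using \<Psi>_int unfolding \<Psi>_def by (simp del: of_nat_Suc)
    also have "\<dots> \<ge> 0"
      using \<Psi>_mono[of "\<tau> + ?e k"] by (intro mult_nonpos_nonpos) auto
    finally show ?thesis .
  qed
  ultimately have "0 \<le> (LINT q|lborel. Kplus (\<tau> + h - q) * g0 q)"
    using LIMSEQ_le_const by blast
  also have "\<dots> = (LINT s:{0..\<tau>}|lborel. K (\<tau> + h - s) *\<^sub>R g s)"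
    unfolding set_lebesgue_integral_def
    by (intro Bochner_Integration.integral_cong) (use h in \<open>auto simp: Kplus_def g0_def split: split_indicator\<close>)
  finally show ?thesis .
qed

section \<open>The comparison principle\<close>

lemma volterra_split:
  fixes g :: "real \<Rightarrow> real"
  assumes g: "continuous_on {0..} g" and "0 \<le> \<tau>" "0 < h"
  shows "volterra K g (\<tau> + h) = (LINT s:{0..\<tau>}|lborel. K (\<tau> + h - s) *\<^sub>R g s)
    + (LINT s:{\<tau><..\<tau> + h}|lborel. K (\<tau> + h - s) *\<^sub>R g s)"
proof -
  have int: "set_integrable lborel {0..\<tau> + h} (\<lambda>s. K (\<tau> + h - s) *\<^sub>R g s)"
    by (rule integrable_conv, rule continuous_on_subset[OF g]) auto
  have "{0..\<tau> + h} = {0..\<tau>} \<union> {\<tau><..\<tau> + h}" using assms by auto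
  then show ?thesis unfolding volterra_def
    by (simp only:, intro set_integral_Un set_integrable_subset[OF int]) (use assms in auto)
qed

text \<open>At the first exit time the past contributes nonnegatively, and so does the present because
  \<open>g > 0\<close> there.\<close>

lemma volterra_nonneg_strict:
  fixes g :: "real \<Rightarrow> real"
  assumes g: "continuous_on {0..} g"
    and pos: "\<And>t. t \<in> {0..T} \<Longrightarrow> volterra K g t = 0 \<Longrightarrow> 0 < g t"
    and t: "t \<in> {0..T}"
  shows "0 \<le> volterra K g t"
proof (rule ccontr)
  define d where "d = volterra K g"
  assume "\<not> 0 \<le> volterra K g t"
  then have dt: "d t < 0" by (simp add: d_def)
  have d_cont: "continuous_on {0..} d" unfolding d_def by (rule volterra_continuous[OF g])
  define S where "S = {s \<in> {0..t}. d s < 0}"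
  \<comment> \<open>First exit time: d \<ge> 0 before \<tau>, while d is negative at \<tau> or at
    times arbitrarily close after it. Continuity then forces d \<tau> = 0.\<close>
  define \<tau> where "\<tau> = Inf S"
  have tS: "t \<in> S" using t dt by (simp add: S_def)
  then have S_ne: "S \<noteq> {}" by blast
  have bdd: "bdd_below S" by (rule bdd_belowI[of _ 0]) (auto simp: S_def)
  have \<tau>: "0 \<le> \<tau>" "\<tau> \<le> t"
    unfolding \<tau>_def using tS bdd by (auto intro!: cInf_greatest cInf_lower simp: S_def)
  have before: "0 \<le> d s" if "0 \<le> s" "s < \<tau>" for s
  proof (rule ccontr)
    assume "\<not> 0 \<le> d s"
    with that \<tau> have "s \<in> S" by (auto simp: S_def)
    then have "\<tau> \<le> s" unfolding \<tau>_def by (rule cInf_lower[OF _ bdd])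
    with that show False by simp
  qed
  have near: "\<exists>s\<in>S. \<tau> \<le> s \<and> s < \<tau> + e" if e: "0 < e" for e
  proof -
    obtain s where "s \<in> S" "s < \<tau> + e"
      using cInf_lessD[OF S_ne, of "\<tau> + e"] e unfolding \<tau>_def by auto
    moreover have "\<tau> \<le> s" unfolding \<tau>_def by (rule cInf_lower[OF \<open>s \<in> S\<close> bdd])
    ultimately show ?thesis by blast
  qed
  have lim: "\<exists>e>0. \<forall>s\<ge>0. \<bar>s - \<tau>\<bar> < e \<longrightarrow> \<bar>f s - f \<tau>\<bar> < r" if "continuous_on {0..} f" "0 < r" for f :: "real \<Rightarrow> real" and r
    using that(1)[unfolded continuous_on_iff dist_real_def, rule_format, of \<tau> r] that(2) \<tau>(1) by auto
  have d\<tau>_le: "d \<tau> \<le> 0"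
  proof (rule ccontr)
    assume "\<not> d \<tau> \<le> 0"
    then obtain e where e: "0 < e" "\<And>s. 0 \<le> s \<Longrightarrow> \<bar>s - \<tau>\<bar> < e \<Longrightarrow> \<bar>d s - d \<tau>\<bar> < d \<tau>"
      using lim[OF d_cont, of "d \<tau>"] by auto
    obtain s where "s \<in> S" "\<tau> \<le> s" "s < \<tau> + e" using near[OF e(1)] by blast
    with e(2)[of s] show False by (auto simp: S_def)
  qed
  have d\<tau>_ge: "0 \<le> d \<tau>"
  proof (cases "\<tau> = 0")
    case True
    \<comment> \<open>At \<tau> = 0 there are no earlier times to take a limit from; instead the
      integral over the single point 0 vanishes.\<close>
    have "d 0 = 0"
      unfolding d_def volterra_def set_lebesgue_integral_def
    proof (rule integral_eq_zero_AE)
      show "AE s in lborel. indicator {0..0} s *\<^sub>R K (0 - s) *\<^sub>R g s = 0"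
        using AE_lborel_singleton[of 0] by eventually_elim auto
    qed
    with True show ?thesis by simp
  next
    case False
    show ?thesis
    proof (rule ccontr)
      assume "\<not> 0 \<le> d \<tau>"
      then obtain e where e: "0 < e" "\<And>s. 0 \<le> s \<Longrightarrow> \<bar>s - \<tau>\<bar> < e \<Longrightarrow> \<bar>d s - d \<tau>\<bar> < - d \<tau>"
        using lim[OF d_cont, of "- d \<tau>"] by auto
      define s where "s = max 0 (\<tau> - e / 2)"
      have "0 \<le> s" "s < \<tau>" "\<bar>s - \<tau>\<bar> < e" using False \<tau>(1) e(1) by (auto simp: s_def)
      with before[of s] e(2)[of s] show False by auto
    qed
  qed
  have past: "0 \<le> volterra K g s" if "0 \<le> s" "s \<le> \<tau>" for s
    using before[of s] d\<tau>_ge that by (cases "s = \<tau>") (auto simp: d_def)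
  have "0 < g \<tau>" using pos[of \<tau>] d\<tau>_le d\<tau>_ge \<tau> t by (auto simp: d_def)
  then obtain e where e: "0 < e" "\<And>s. 0 \<le> s \<Longrightarrow> \<bar>s - \<tau>\<bar> < e \<Longrightarrow> \<bar>g s - g \<tau>\<bar> < g \<tau>"
    using lim[OF g, of "g \<tau>"] by auto
  obtain s where s: "s \<in> S" "\<tau> \<le> s" "s < \<tau> + e" using near[OF e(1)] by blast
  \<comment> \<open>The window (\<tau>, s] is short enough for \<open>g\<close> to stay positive on
    it, so past and present both contribute nonnegatively to d s, contradicting s \<in> S.\<close>
  define h where "h = s - \<tau>"
  have "s \<noteq> \<tau>" using s(1) d\<tau>_ge by (auto simp: S_def)
  with s have h: "0 < h" "h < e" by (auto simp: h_def)
  have "0 \<le> (LINT r:{\<tau><..\<tau> + h}|lborel. K (\<tau> + h - r) *\<^sub>R g r)"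
    unfolding set_lebesgue_integral_def
  proof (rule integral_nonneg_AE)
    show "AE r in lborel. 0 \<le> indicator {\<tau><..\<tau> + h} r *\<^sub>R K (\<tau> + h - r) *\<^sub>R g r"
      using AE_lborel_singleton[of "\<tau> + h"]
    proof eventually_elim
      fix r assume r: "r \<noteq> \<tau> + h"
      show "0 \<le> indicator {\<tau><..\<tau> + h} r *\<^sub>R K (\<tau> + h - r) *\<^sub>R g r"
      proof (cases "r \<in> {\<tau><..\<tau> + h}")
        case True
        with e(2)[of r] h \<tau> have "0 < g r" by auto
        moreover have "0 \<le> K (\<tau> + h - r)" using True r by (intro K_nonneg) auto
        ultimately show ?thesis by simp
      qed simp
    qed
  qed
  moreover have "0 \<le> (LINT s:{0..\<tau>}|lborel. K (\<tau> + h - s) *\<^sub>R g s)"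
    by (rule future_of_nonneg_past[OF g \<tau>(1) h(1) past])
  ultimately have "0 \<le> d (\<tau> + h)" unfolding d_def volterra_split[OF g \<tau>(1) h(1)] by simp
  then show False using s(1) by (simp add: S_def h_def)
qed

text \<open>The constant in the lower bound may depend on the horizon, which accommodates locally
  Lipschitz nonlinearities evaluated along bounded paths.\<close>

theorem volterra_comparison:
  fixes g :: "real \<Rightarrow> real"
  assumes g: "continuous_on {0..} g"
    and d: "\<And>t. 0 \<le> t \<Longrightarrow> d t = volterra K g t"
    and lower: "\<And>T. \<exists>C\<ge>0. \<forall>t\<in>{0..T}. d t \<le> 0 \<longrightarrow> C * d t \<le> g t"
    and t: "0 \<le> t"
  shows "0 \<le> d t"
proof -
  obtain C where C: "0 \<le> C" "\<And>s. s \<in> {0..t} \<Longrightarrow> d s \<le> 0 \<Longrightarrow> C * d s \<le> g s"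
    using lower[of t] by blast
  obtain z where z: "continuous_on {0..} z" "\<And>s. 0 \<le> s \<Longrightarrow> 0 \<le> z s"
    "\<And>s. 0 \<le> s \<Longrightarrow> z s = volterra K (\<lambda>s. 1 + C * z s) s"
    by (rule volterra_affine_majorant[of "\<lambda>_. 1" C]) (auto simp: C(1))
  have "0 \<le> d t + e * z t" if e: "0 < e" for e
  proof -
    have eq: "volterra K (\<lambda>s. g s + e * (1 + C * z s)) s = d s + e * z s" if "0 \<le> s" for s
    proof -
      have "continuous_on {0..s} (\<lambda>s. e * (1 + C * z s))" by (intro continuous_on_atLeast_imp_Icc continuous_intros z(1))
      then show ?thesis
        unfolding d[OF that] z(3)[OF that]
        by (simp only: volterra_add[OF continuous_on_atLeast_imp_Icc[OF g]] volterra_cmult)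
    qed
    have "0 \<le> volterra K (\<lambda>s. g s + e * (1 + C * z s)) t"
    proof (rule volterra_nonneg_strict[where T = t])
      show "continuous_on {0..} (\<lambda>s. g s + e * (1 + C * z s))" by (intro continuous_intros g z(1))
      fix s assume s: "s \<in> {0..t}" "volterra K (\<lambda>s. g s + e * (1 + C * z s)) s = 0"
      \<comment> \<open>At a zero of d + e z one has d = -e z \<le> 0, so the perturbed forcing is
        at least -C e z + e (1 + C z) = e > 0.\<close>
      then have ds: "d s = - (e * z s)" using eq[of s] by auto
      then have "d s \<le> 0" using e z(2)[of s] s by auto
      then have "C * d s \<le> g s" using C(2) s by auto
      then have "- (e * (C * z s)) \<le> g s" by (simp add: ds algebra_simps)
      then show "0 < g s + e * (1 + C * z s)" using z(2)[of s] s e by (simp add: algebra_simps)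
    qed (use t in auto)
    with eq[OF t] show ?thesis by simp
  qed
  note nonneg = this
  show ?thesis
  proof (rule tendsto_lowerbound)
    have "((\<lambda>e. d t + e * z t) \<longlongrightarrow> d t + 0 * z t) (at_right 0)" by (intro tendsto_intros)
    then show "((\<lambda>e. d t + e * z t) \<longlongrightarrow> d t) (at_right 0)" by simp
    show "\<forall>\<^sub>F e in at_right 0. 0 \<le> d t + e * z t"
      using nonneg by (auto simp: eventually_at_filter)
  qed simp
qed

end

section \<open>Riccati equations on the left half-plane\<close>

text \<open>For k, c \<ge> 0 this is the nearest-point projection onto the rectangle with real part
  in [-k, 0] and imaginary part in [-c, c].\<close>

definition rect_clamp :: "real \<Rightarrow> real \<Rightarrow> complex \<Rightarrow> complex" where
  "rect_clamp k c u = Complex (max (- k) (min (Re u) 0)) (max (- c) (min (Im u) c))"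

lemma norm_rect_clamp_le: "0 \<le> k \<Longrightarrow> 0 \<le> c \<Longrightarrow> norm (rect_clamp k c u) \<le> k + c"
  by (rule order_trans[OF cmod_le]) (auto simp: rect_clamp_def max_def min_def)

text \<open>Clamping is 1-Lipschitz in each coordinate, and each coordinate is bounded by the norm;
  hence the crude constant 2.\<close>

lemma rect_clamp_lipschitz: "norm (rect_clamp k c u - rect_clamp k c v) \<le> 2 * norm (u - v)"
proof -
  have "norm (rect_clamp k c u - rect_clamp k c v) \<le> \<bar>Re u - Re v\<bar> + \<bar>Im u - Im v\<bar>"
    by (rule order_trans[OF cmod_le]) (auto simp: rect_clamp_def max_def min_def)
  with abs_Re_le_cmod[of "u - v"] abs_Im_le_cmod[of "u - v"] show ?thesis by simp
qed

text \<open>Continuity is local: the Lipschitz bound for R = |u| + 1 covers the unit ball about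
  u.\<close>

lemma halfplane_lipschitz_continuous:
  fixes \<Phi> :: "complex \<Rightarrow> complex"
  assumes lip: "\<And>R. \<exists>C. \<forall>u v. Re u \<le> 0 \<longrightarrow> Re v \<le> 0 \<longrightarrow> norm u \<le> R \<longrightarrow> norm v \<le> R \<longrightarrow>
      norm (\<Phi> u - \<Phi> v) \<le> C * norm (u - v)"
  shows "continuous_on {u. Re u \<le> 0} \<Phi>"
proof (rule continuous_on_eq_continuous_within[THEN iffD2], rule ballI)
  fix u :: complex assume u: "u \<in> {u. Re u \<le> 0}"
  obtain C where C: "\<And>x y. Re x \<le> 0 \<Longrightarrow> Re y \<le> 0 \<Longrightarrow> norm x \<le> norm u + 1 \<Longrightarrow> norm y \<le> norm u + 1 \<Longrightarrow>
    norm (\<Phi> x - \<Phi> y) \<le> C * norm (x - y)"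
    using lip[of "norm u + 1"] by blast
  have "continuous_on ({u. Re u \<le> 0} \<inter> ball u 1) \<Phi>"
  proof (intro lipschitz_on_continuous_on lipschitz_onI)
    fix x y assume xy: "x \<in> {u. Re u \<le> 0} \<inter> ball u 1" "y \<in> {u. Re u \<le> 0} \<inter> ball u 1"
    have "norm z \<le> norm u + 1" if "z \<in> ball u 1" for z
      using norm_triangle_sub[of z u] that by (simp add: dist_norm norm_minus_commute)
    then have "norm (\<Phi> x - \<Phi> y) \<le> C * norm (x - y)" using xy by (intro C) auto
    also have "\<dots> \<le> \<bar>C\<bar> * norm (x - y)" by (intro mult_right_mono) auto
    finally show "dist (\<Phi> x) (\<Phi> y) \<le> \<bar>C\<bar> * dist x y" by (simp add: dist_norm)
  qed simp
  then have "continuous (at u within {u. Re u \<le> 0} \<inter> ball u 1) \<Phi>"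
    using u by (auto simp: continuous_on_eq_continuous_within)
  moreover have "at u within {u. Re u \<le> 0} \<inter> ball u 1 = at u within {u. Re u \<le> 0}"
    by (rule at_within_nhd[of _ "ball u 1"]) auto
  ultimately show "continuous (at u within {u. Re u \<le> 0}) \<Phi>" by simp
qed

context resolvent_kernel
begin

text \<open>The nonlinearity is evaluated at the projection of \<open>\<psi>(t)\<close> to a rectangle
  \<open>[-\<kappa>(t), 0] \<times> [-\<eta>(t), \<eta>(t)]\<close> whose edges solve linear equations, so that it becomes globally
  Lipschitz.  The comparison principle then shows that the solution never leaves the rectangle.\<close>

theorem complex_riccati_existence:
  fixes f :: "real \<Rightarrow> complex" and \<Phi> :: "complex \<Rightarrow> complex"
  assumes f: "continuous_on {0..} f" "\<And>t. 0 \<le> t \<Longrightarrow> Re (f t) \<le> 0"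
    and lip: "\<And>R. \<exists>C. \<forall>u v. Re u \<le> 0 \<longrightarrow> Re v \<le> 0 \<longrightarrow> norm u \<le> R \<longrightarrow> norm v \<le> R \<longrightarrow>
      norm (\<Phi> u - \<Phi> v) \<le> C * norm (u - v)"
    and upper: "\<And>u. Re u = 0 \<Longrightarrow> Re (\<Phi> u) \<le> 0"
    and A: "0 \<le> A"
    and lower: "\<And>u. Re u \<le> 0 \<Longrightarrow> b * Re u - A * (Im u)\<^sup>2 \<le> Re (\<Phi> u)"
    and Im_upper: "\<And>u. Re u \<le> 0 \<Longrightarrow> 0 \<le> Im u \<Longrightarrow> Im (\<Phi> u) \<le> b * Im u"
    and Im_lower: "\<And>u. Re u \<le> 0 \<Longrightarrow> Im u \<le> 0 \<Longrightarrow> b * Im u \<le> Im (\<Phi> u)"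
  obtains \<psi> where "continuous_on {0..} \<psi>" "\<And>t. 0 \<le> t \<Longrightarrow> Re (\<psi> t) \<le> 0"
    "\<And>t. 0 \<le> t \<Longrightarrow> \<psi> t = volterra K (\<lambda>s. f s + \<Phi> (\<psi> s)) t"
proof -
  \<comment> \<open>\<open>\<eta>\<close> is to dominate |Im \<psi>|: its forcing |Im f| + |b|
    \<eta> majorizes that of Im \<psi> and of -Im \<psi> on the horizontal edges.\<close>
  obtain \<eta> where \<eta>: "continuous_on {0..} \<eta>" "\<And>t. 0 \<le> t \<Longrightarrow> 0 \<le> \<eta> t"
    "\<And>t. 0 \<le> t \<Longrightarrow> \<eta> t = volterra K (\<lambda>s. \<bar>Im (f s)\<bar> + \<bar>b\<bar> * \<eta> s) t"
    by (rule volterra_affine_majorant[of "\<lambda>s. \<bar>Im (f s)\<bar>" "\<bar>b\<bar>"]) (auto intro!: continuous_intros f)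
  \<comment> \<open>\<open>\<kappa>\<close> is to dominate -Re \<psi>: for imaginary parts of
    modulus at most \<eta>, the quadratic loss in the lower bound on Re \<Phi> is at most A
    \<eta>^2.\<close>
  obtain \<kappa> where \<kappa>: "continuous_on {0..} \<kappa>" "\<And>t. 0 \<le> t \<Longrightarrow> 0 \<le> \<kappa> t"
    "\<And>t. 0 \<le> t \<Longrightarrow> \<kappa> t = volterra K (\<lambda>s. (A * (\<eta> s)\<^sup>2 - Re (f s)) + \<bar>b\<bar> * \<kappa> s) t"
  proof (rule volterra_affine_majorant[of "\<lambda>s. A * (\<eta> s)\<^sup>2 - Re (f s)" "\<bar>b\<bar>"])
    show "0 \<le> A * (\<eta> t)\<^sup>2 - Re (f t)" if "0 \<le> t" for t
    proof -
      have "0 \<le> A * (\<eta> t)\<^sup>2" using A by simp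
      with f(2)[OF that] show ?thesis by linarith
    qed
  qed (auto intro!: continuous_intros f \<eta>)
  define \<pi> where "\<pi> s u = rect_clamp (\<kappa> s) (\<eta> s) u" for s u
  have \<pi>_Re: "Re (\<pi> s u) = max (- \<kappa> s) (min (Re u) 0)" and \<pi>_Im: "Im (\<pi> s u) = max (- \<eta> s) (min (Im u) (\<eta> s))" for s u
    by (simp_all add: \<pi>_def rect_clamp_def)
  have \<pi>_nonpos: "Re (\<pi> s u) \<le> 0" if "0 \<le> s" for s u using \<kappa>(2)[OF that] by (simp add: \<pi>_Re)
  have \<Phi>_cont: "continuous_on {u. Re u \<le> 0} \<Phi>" by (rule halfplane_lipschitz_continuous[OF lip])
  define G where "G s u = f s + \<Phi> (\<pi> s u)" for s u
  have G_cont: "continuous_on {0..} (\<lambda>s. G s (\<psi> s))" if "continuous_on {0..} \<psi>" for \<psi>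
    unfolding G_def
  proof (intro continuous_intros f continuous_on_compose2[OF \<Phi>_cont])
    show "continuous_on {0..} (\<lambda>s. \<pi> s (\<psi> s))"
      unfolding \<pi>_def rect_clamp_def Complex_eq by (intro continuous_intros \<kappa> \<eta> that)
  qed (use \<pi>_nonpos in auto)
  obtain \<psi> where \<psi>: "continuous_on {0..} \<psi>" "\<And>t. 0 \<le> t \<Longrightarrow> \<psi> t = volterra K (\<lambda>s. G s (\<psi> s)) t"
  proof (rule volterra_lipschitz_existence[of G])
    show "\<exists>C. \<forall>s\<in>{0..T}. \<forall>u v. norm (G s u - G s v) \<le> C * norm (u - v)" for T
    proof -
      have "bounded ((\<lambda>s. \<kappa> s + \<eta> s) ` {0..T})"
        by (intro compact_imp_bounded compact_continuous_image compact_Icc continuous_on_atLeast_imp_Icc continuous_intros \<kappa>(1) \<eta>(1))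
      then obtain R where R: "\<And>s. s \<in> {0..T} \<Longrightarrow> norm (\<kappa> s + \<eta> s) \<le> R"
        unfolding bounded_iff by blast
      obtain C where C: "\<And>u v. Re u \<le> 0 \<Longrightarrow> Re v \<le> 0 \<Longrightarrow> norm u \<le> R \<Longrightarrow> norm v \<le> R \<Longrightarrow>
        norm (\<Phi> u - \<Phi> v) \<le> C * norm (u - v)"
        using lip[of R] by blast
      have "norm (G s u - G s v) \<le> (2 * \<bar>C\<bar>) * norm (u - v)" if s: "s \<in> {0..T}" for s u v
      proof -
        have R': "norm (\<pi> s u) \<le> R" for u
          using norm_rect_clamp_le[of "\<kappa> s" "\<eta> s" u] R[OF s] \<kappa>(2)[of s] \<eta>(2)[of s] s by (auto simp: \<pi>_def)
        have "norm (G s u - G s v) \<le> C * norm (\<pi> s u - \<pi> s v)"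
          using s by (auto simp: G_def intro!: C \<pi>_nonpos R')
        also have "\<dots> \<le> \<bar>C\<bar> * norm (\<pi> s u - \<pi> s v)" by (intro mult_right_mono) auto
        also have "\<dots> \<le> \<bar>C\<bar> * (2 * norm (u - v))"
          unfolding \<pi>_def by (intro mult_left_mono rect_clamp_lipschitz) auto
        finally show ?thesis by simp
      qed
      then show ?thesis by blast
    qed
  qed (use G_cont in auto)
  note G\<psi> = G_cont[OF \<psi>(1)]
  have Re_\<psi>: "Re (\<psi> t) = volterra K (\<lambda>s. Re (G s (\<psi> s))) t"
    and Im_\<psi>: "Im (\<psi> t) = volterra K (\<lambda>s. Im (G s (\<psi> s))) t" if "0 \<le> t" for t
    using \<psi>(2)[OF that] volterra_Re[OF continuous_on_atLeast_imp_Icc[OF G\<psi>]] volterra_Im[OF continuous_on_atLeast_imp_Icc[OF G\<psi>]] by auto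
  have ReG: "continuous_on {0..} (\<lambda>s. Re (G s (\<psi> s)))" and ImG: "continuous_on {0..} (\<lambda>s. Im (G s (\<psi> s)))"
    by (intro continuous_intros G\<psi>)+
  have \<eta>g: "continuous_on {0..} (\<lambda>s. \<bar>Im (f s)\<bar> + \<bar>b\<bar> * \<eta> s)"
    by (intro continuous_intros f \<eta>)
  have \<kappa>g: "continuous_on {0..} (\<lambda>s. (A * (\<eta> s)\<^sup>2 - Re (f s)) + \<bar>b\<bar> * \<kappa> s)"
    by (intro continuous_intros f \<eta> \<kappa>)
  have b\<eta>: "b * \<eta> s \<le> \<bar>b\<bar> * \<eta> s" "b * \<kappa> s \<le> \<bar>b\<bar> * \<kappa> s" if "0 \<le> s" for s
    using \<eta>(2)[OF that] \<kappa>(2)[OF that] by (auto intro!: mult_right_mono)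
  \<comment> \<open>Each of the four comparisons concerns times at which \<psi> is on or beyond one
    edge. There the projection lies on that edge, and the bounds on \<Phi> give the forcing the
    right sign, so C = 0 works.\<close>
  have Re_le: "0 \<le> - Re (\<psi> t)" if t: "0 \<le> t" for t
  proof (rule volterra_comparison[of "\<lambda>s. - Re (G s (\<psi> s))" "\<lambda>t. - Re (\<psi> t)", OF _ _ _ t])
    show "- Re (\<psi> t) = volterra K (\<lambda>s. - Re (G s (\<psi> s))) t" if "0 \<le> t" for t
      using Re_\<psi>[OF that] volterra_cmult[of "-1" "\<lambda>s. Re (G s (\<psi> s))" t] by simp
    show "\<exists>C\<ge>0. \<forall>t\<in>{0..T}. - Re (\<psi> t) \<le> 0 \<longrightarrow> C * - Re (\<psi> t) \<le> - Re (G t (\<psi> t))" for T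
    proof (intro exI[of _ 0] conjI ballI impI)
      fix s assume s: "s \<in> {0..T}" "- Re (\<psi> s) \<le> 0"
      then have "Re (\<pi> s (\<psi> s)) = 0" using \<kappa>(2)[of s] by (simp add: \<pi>_Re)
      from upper[OF this] f(2)[of s] s show "0 * - Re (\<psi> s) \<le> - Re (G s (\<psi> s))" by (simp add: G_def)
    qed simp
  qed (auto intro!: continuous_intros ReG)
  have Im_le: "0 \<le> \<eta> t - Im (\<psi> t)" if t: "0 \<le> t" for t
  proof (rule volterra_comparison[of "\<lambda>s. (\<bar>Im (f s)\<bar> + \<bar>b\<bar> * \<eta> s) - Im (G s (\<psi> s))" "\<lambda>t. \<eta> t - Im (\<psi> t)", OF _ _ _ t])
    show "\<eta> t - Im (\<psi> t) = volterra K (\<lambda>s. (\<bar>Im (f s)\<bar> + \<bar>b\<bar> * \<eta> s) - Im (G s (\<psi> s))) t" if "0 \<le> t" for t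
      unfolding volterra_diff[OF continuous_on_atLeast_imp_Icc[OF \<eta>g] continuous_on_atLeast_imp_Icc[OF ImG]] using \<eta>(3)[OF that] Im_\<psi>[OF that] by simp
    show "\<exists>C\<ge>0. \<forall>t\<in>{0..T}. \<eta> t - Im (\<psi> t) \<le> 0 \<longrightarrow>
        C * (\<eta> t - Im (\<psi> t)) \<le> (\<bar>Im (f t)\<bar> + \<bar>b\<bar> * \<eta> t) - Im (G t (\<psi> t))" for T
    proof (intro exI[of _ 0] conjI ballI impI)
      fix s assume s: "s \<in> {0..T}" "\<eta> s - Im (\<psi> s) \<le> 0"
      then have "Im (\<pi> s (\<psi> s)) = \<eta> s" using \<eta>(2)[of s] by (simp add: \<pi>_Im)
      with Im_upper[of "\<pi> s (\<psi> s)"] \<pi>_nonpos[of s] \<eta>(2)[of s] s(1) b\<eta>(1)[of s]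
      show "0 * (\<eta> s - Im (\<psi> s)) \<le> (\<bar>Im (f s)\<bar> + \<bar>b\<bar> * \<eta> s) - Im (G s (\<psi> s))" by (simp add: G_def)
    qed simp
  qed (intro continuous_intros \<eta>g ImG)
  have Im_ge: "0 \<le> \<eta> t + Im (\<psi> t)" if t: "0 \<le> t" for t
  proof (rule volterra_comparison[of "\<lambda>s. (\<bar>Im (f s)\<bar> + \<bar>b\<bar> * \<eta> s) + Im (G s (\<psi> s))" "\<lambda>t. \<eta> t + Im (\<psi> t)", OF _ _ _ t])
    show "\<eta> t + Im (\<psi> t) = volterra K (\<lambda>s. (\<bar>Im (f s)\<bar> + \<bar>b\<bar> * \<eta> s) + Im (G s (\<psi> s))) t" if "0 \<le> t" for t
      unfolding volterra_add[OF continuous_on_atLeast_imp_Icc[OF \<eta>g] continuous_on_atLeast_imp_Icc[OF ImG]] using \<eta>(3)[OF that] Im_\<psi>[OF that] by simp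
    show "\<exists>C\<ge>0. \<forall>t\<in>{0..T}. \<eta> t + Im (\<psi> t) \<le> 0 \<longrightarrow>
        C * (\<eta> t + Im (\<psi> t)) \<le> (\<bar>Im (f t)\<bar> + \<bar>b\<bar> * \<eta> t) + Im (G t (\<psi> t))" for T
    proof (intro exI[of _ 0] conjI ballI impI)
      fix s assume s: "s \<in> {0..T}" "\<eta> s + Im (\<psi> s) \<le> 0"
      then have "Im (\<pi> s (\<psi> s)) = - \<eta> s" using \<eta>(2)[of s] by (simp add: \<pi>_Im)
      with Im_lower[of "\<pi> s (\<psi> s)"] \<pi>_nonpos[of s] \<eta>(2)[of s] s(1) b\<eta>(1)[of s]
      show "0 * (\<eta> s + Im (\<psi> s)) \<le> (\<bar>Im (f s)\<bar> + \<bar>b\<bar> * \<eta> s) + Im (G s (\<psi> s))" by (simp add: G_def)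
    qed simp
  qed (intro continuous_intros \<eta>g ImG)
  have Re_ge: "0 \<le> \<kappa> t + Re (\<psi> t)" if t: "0 \<le> t" for t
  proof (rule volterra_comparison[of "\<lambda>s. ((A * (\<eta> s)\<^sup>2 - Re (f s)) + \<bar>b\<bar> * \<kappa> s) + Re (G s (\<psi> s))" "\<lambda>t. \<kappa> t + Re (\<psi> t)", OF _ _ _ t])
    show "\<kappa> t + Re (\<psi> t) = volterra K (\<lambda>s. ((A * (\<eta> s)\<^sup>2 - Re (f s)) + \<bar>b\<bar> * \<kappa> s) + Re (G s (\<psi> s))) t" if "0 \<le> t" for t
      unfolding volterra_add[OF continuous_on_atLeast_imp_Icc[OF \<kappa>g] continuous_on_atLeast_imp_Icc[OF ReG]] using \<kappa>(3)[OF that] Re_\<psi>[OF that] by simp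
    show "\<exists>C\<ge>0. \<forall>t\<in>{0..T}. \<kappa> t + Re (\<psi> t) \<le> 0 \<longrightarrow>
        C * (\<kappa> t + Re (\<psi> t)) \<le> ((A * (\<eta> t)\<^sup>2 - Re (f t)) + \<bar>b\<bar> * \<kappa> t) + Re (G t (\<psi> t))" for T
    proof (intro exI[of _ 0] conjI ballI impI)
      fix s assume s: "s \<in> {0..T}" "\<kappa> s + Re (\<psi> s) \<le> 0"
      then have Re_eq: "Re (\<pi> s (\<psi> s)) = - \<kappa> s" using \<kappa>(2)[of s] by (simp add: \<pi>_Re)
      \<comment> \<open>This bound comes from the projection itself and not from the comparisons for
        Im \<psi>.\<close>
      have "\<bar>Im (\<pi> s (\<psi> s))\<bar> \<le> \<eta> s" using \<eta>(2)[of s] s(1) by (auto simp: \<pi>_Im)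
      then have "\<bar>Im (\<pi> s (\<psi> s))\<bar>\<^sup>2 \<le> (\<eta> s)\<^sup>2" by (intro power_mono) auto
      then have "A * (Im (\<pi> s (\<psi> s)))\<^sup>2 \<le> A * (\<eta> s)\<^sup>2" using A by (simp add: mult_left_mono)
      with lower[of "\<pi> s (\<psi> s)"] \<pi>_nonpos[of s] s(1) b\<eta>(2)[of s] \<kappa>(2)[of s] Re_eq
      show "0 * (\<kappa> s + Re (\<psi> s)) \<le> ((A * (\<eta> s)\<^sup>2 - Re (f s)) + \<bar>b\<bar> * \<kappa> s) + Re (G s (\<psi> s))" by (simp add: G_def)
    qed simp
  qed (intro continuous_intros \<kappa>g ReG)
  have "\<psi> t = volterra K (\<lambda>s. f s + \<Phi> (\<psi> s)) t" if t: "0 \<le> t" for t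
    unfolding \<psi>(2)[OF t]
  proof (rule volterra_cong)
    fix s :: real assume s: "0 \<le> s"
    \<comment> \<open>Inside the rectangle the projection is the identity, so the truncated equation
      is the original one.\<close>
    have "\<pi> s (\<psi> s) = \<psi> s"
      using Re_le[OF s] Re_ge[OF s] Im_le[OF s] Im_ge[OF s] by (intro complex_eqI) (auto simp: \<pi>_Re \<pi>_Im)
    then show "G s (\<psi> s) = f s + \<Phi> (\<psi> s)" by (simp add: G_def)
  qed
  with \<psi>(1) Re_le that show ?thesis by force
qed

text \<open>Where Im \<psi> \<le> 0, Im \<Phi>(\<psi>) \<ge> b Im \<psi> \<ge> |b| Im \<psi>, which
  is the bound the comparison principle asks for; the mirrored estimate treats -Im \<psi>.\<close>

lemma complex_riccati_real:
  fixes f :: "real \<Rightarrow> complex" and \<Phi> :: "complex \<Rightarrow> complex"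
  assumes \<psi>: "continuous_on {0..} (\<lambda>s. f s + \<Phi> (\<psi> s))" "\<And>t. 0 \<le> t \<Longrightarrow> Re (\<psi> t) \<le> 0"
    "\<And>t. 0 \<le> t \<Longrightarrow> \<psi> t = volterra K (\<lambda>s. f s + \<Phi> (\<psi> s)) t"
    and f: "\<And>t. 0 \<le> t \<Longrightarrow> Im (f t) = 0"
    and Im_upper: "\<And>u. Re u \<le> 0 \<Longrightarrow> 0 \<le> Im u \<Longrightarrow> Im (\<Phi> u) \<le> b * Im u"
    and Im_lower: "\<And>u. Re u \<le> 0 \<Longrightarrow> Im u \<le> 0 \<Longrightarrow> b * Im u \<le> Im (\<Phi> u)"
    and t: "0 \<le> t"
  shows "Im (\<psi> t) = 0"
proof (rule antisym)
  let ?g = "\<lambda>s. Im (f s + \<Phi> (\<psi> s))"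
  have g: "continuous_on {0..} ?g" by (rule continuous_on_Im[OF \<psi>(1)])
  have Im_\<psi>: "Im (\<psi> t) = volterra K ?g t" if "0 \<le> t" for t
    using \<psi>(3)[OF that] volterra_Im[OF continuous_on_atLeast_imp_Icc[OF \<psi>(1)]] by simp
  show "0 \<le> Im (\<psi> t)"
  proof (rule volterra_comparison[OF g Im_\<psi> _ t])
    show "\<exists>C\<ge>0. \<forall>t\<in>{0..T}. Im (\<psi> t) \<le> 0 \<longrightarrow> C * Im (\<psi> t) \<le> ?g t" for T
    proof (intro exI[of _ "\<bar>b\<bar>"] conjI ballI impI)
      fix s assume s: "s \<in> {0..T}" "Im (\<psi> s) \<le> 0"
      then have "\<bar>b\<bar> * Im (\<psi> s) \<le> b * Im (\<psi> s)" by (intro mult_right_mono_neg) auto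
      with Im_lower[of "\<psi> s"] \<psi>(2)[of s] f[of s] s show "\<bar>b\<bar> * Im (\<psi> s) \<le> ?g s" by simp
    qed simp
  qed
  have "0 \<le> - Im (\<psi> t)"
  proof (rule volterra_comparison[of "\<lambda>s. - ?g s" "\<lambda>t. - Im (\<psi> t)", OF _ _ _ t])
    show "- Im (\<psi> t) = volterra K (\<lambda>s. - ?g s) t" if "0 \<le> t" for t
      using Im_\<psi>[OF that] volterra_cmult[of "-1" ?g t] by simp
    show "\<exists>C\<ge>0. \<forall>t\<in>{0..T}. - Im (\<psi> t) \<le> 0 \<longrightarrow> C * - Im (\<psi> t) \<le> - ?g t" for T
    proof (intro exI[of _ "\<bar>b\<bar>"] conjI ballI impI)
      fix s assume s: "s \<in> {0..T}" "- Im (\<psi> s) \<le> 0"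
      then have "b * Im (\<psi> s) \<le> \<bar>b\<bar> * Im (\<psi> s)" by (intro mult_right_mono) auto
      with Im_upper[of "\<psi> s"] \<psi>(2)[of s] f[of s] s show "\<bar>b\<bar> * - Im (\<psi> s) \<le> - ?g s" by simp
    qed simp
  qed (rule continuous_on_minus[OF g])
  then show "Im (\<psi> t) \<le> 0" by simp
qed

text \<open>For d = x - Re \<psi> the forcing is \<phi>(x) - Re \<Phi>(\<psi>) \<ge> \<phi>(x) -
  \<phi>(Re \<psi>), and the local Lipschitz bound makes this at least |C| d where d \<le>
  0.\<close>

lemma riccati_comparison:
  fixes f :: "real \<Rightarrow> complex" and \<Phi> :: "complex \<Rightarrow> complex"
  assumes cont: "continuous_on {0..} (\<lambda>s. f s + \<Phi> (\<psi> s))" "continuous_on {0..} (\<lambda>s. Re (f s) + \<phi> (x s))"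
    and \<psi>: "continuous_on {0..} \<psi>" "\<And>t. 0 \<le> t \<Longrightarrow> Re (\<psi> t) \<le> 0"
      "\<And>t. 0 \<le> t \<Longrightarrow> \<psi> t = volterra K (\<lambda>s. f s + \<Phi> (\<psi> s)) t"
    and x: "continuous_on {0..} x" "\<And>t. 0 \<le> t \<Longrightarrow> x t \<le> 0"
      "\<And>t. 0 \<le> t \<Longrightarrow> x t = volterra K (\<lambda>s. Re (f s) + \<phi> (x s)) t"
    and dominated: "\<And>u. Re u \<le> 0 \<Longrightarrow> Re (\<Phi> u) \<le> \<phi> (Re u)"
    and lip: "\<And>R. \<exists>C. \<forall>r s. r \<le> 0 \<longrightarrow> s \<le> 0 \<longrightarrow> \<bar>r\<bar> \<le> R \<longrightarrow> \<bar>s\<bar> \<le> R \<longrightarrow> \<bar>\<phi> r - \<phi> s\<bar> \<le> C * \<bar>r - s\<bar>"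
    and t: "0 \<le> t"
  shows "Re (\<psi> t) \<le> x t"
proof -
  let ?g = "\<lambda>s. (Re (f s) + \<phi> (x s)) - Re (f s + \<Phi> (\<psi> s))"
  note Re_cont = continuous_on_Re[OF cont(1)]
  have "0 \<le> x t - Re (\<psi> t)"
  proof (rule volterra_comparison[of ?g "\<lambda>t. x t - Re (\<psi> t)", OF _ _ _ t])
    show "x t - Re (\<psi> t) = volterra K ?g t" if "0 \<le> t" for t
      unfolding volterra_diff[OF continuous_on_atLeast_imp_Icc[OF cont(2)] continuous_on_atLeast_imp_Icc[OF Re_cont]]
      using x(3)[OF that] \<psi>(3)[OF that] volterra_Re[OF continuous_on_atLeast_imp_Icc[OF cont(1)]] by simp
    show "\<exists>C\<ge>0. \<forall>t\<in>{0..T}. x t - Re (\<psi> t) \<le> 0 \<longrightarrow> C * (x t - Re (\<psi> t)) \<le> ?g t" for T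
    proof -
      have "bounded ((\<lambda>s. \<bar>x s\<bar> + norm (\<psi> s)) ` {0..T})"
        by (intro compact_imp_bounded compact_continuous_image compact_Icc continuous_on_atLeast_imp_Icc
          continuous_intros x(1) \<psi>(1))
      then obtain R where R: "\<And>s. s \<in> {0..T} \<Longrightarrow> norm (\<bar>x s\<bar> + norm (\<psi> s)) \<le> R"
        unfolding bounded_iff by blast
      obtain C where C: "\<And>r s. r \<le> 0 \<Longrightarrow> s \<le> 0 \<Longrightarrow> \<bar>r\<bar> \<le> R \<Longrightarrow> \<bar>s\<bar> \<le> R \<Longrightarrow> \<bar>\<phi> r - \<phi> s\<bar> \<le> C * \<bar>r - s\<bar>"
        using lip[of R] by blast
      have "\<bar>C\<bar> * (x s - Re (\<psi> s)) \<le> ?g s" if s: "s \<in> {0..T}" "x s - Re (\<psi> s) \<le> 0" for s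
      proof -
        have "\<bar>\<phi> (x s) - \<phi> (Re (\<psi> s))\<bar> \<le> C * \<bar>x s - Re (\<psi> s)\<bar>"
          using R[OF s(1)] abs_Re_le_cmod[of "\<psi> s"] s(1) by (intro C x(2) \<psi>(2)) auto
        also have "\<dots> \<le> \<bar>C\<bar> * \<bar>x s - Re (\<psi> s)\<bar>" by (intro mult_right_mono) auto
        also have "\<dots> = - (\<bar>C\<bar> * (x s - Re (\<psi> s)))" using s(2) by (simp add: right_diff_distrib)
        finally show ?thesis using dominated[OF \<psi>(2)[of s]] s(1) by simp
      qed
      then show ?thesis by (intro exI[of _ "\<bar>C\<bar>"]) auto
    qed
  qed (intro continuous_on_diff cont(2) Re_cont)
  then show ?thesis by simp
qed

end

section \<open>The jump exponent\<close>

text \<open>Mean value inequality on the convex half-plane, where the derivative of exp has modulus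
  at most 1.\<close>

lemma norm_exp_minus_1_le:
  fixes z :: complex
  assumes "Re z \<le> 0"
  shows "norm (exp z - 1) \<le> norm z"
proof -
  have "norm (exp z - exp 0) \<le> 1 * norm (z - 0)"
  proof (rule field_differentiable_bound)
    show "convex {z. Re z \<le> 0}" by (rule convex_halfspace_Re_le)
    show "(exp has_field_derivative exp w) (at w within {z. Re z \<le> 0})" for w :: complex
      by (rule DERIV_exp[THEN has_field_derivative_at_within])
  qed (use assms in auto)
  then show ?thesis by simp
qed

text \<open>On the convex half-disc the derivative (exp(z \<xi>) - 1) \<xi> has modulus at most |z|
  \<xi>^2 \<le> R \<xi>^2; the factor \<xi>^2 is integrable by the moment condition.\<close>

lemma compensated_exp_lipschitz:
  fixes u v :: complex
  assumes "0 \<le> \<xi>" "Re u \<le> 0" "Re v \<le> 0" "norm u \<le> R" "norm v \<le> R"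
  shows "norm ((exp (u * of_real \<xi>) - 1 - u * of_real \<xi>) - (exp (v * of_real \<xi>) - 1 - v * of_real \<xi>))
    \<le> R * norm (u - v) * \<xi>\<^sup>2"
proof -
  let ?S = "{z. Re z \<le> 0} \<inter> cball 0 R"
  let ?f = "\<lambda>z. exp (z * of_real \<xi>) - 1 - z * of_real \<xi> :: complex"
  have "norm (?f u - ?f v) \<le> R * \<xi>\<^sup>2 * norm (u - v)"
  proof (rule field_differentiable_bound)
    show "convex ?S" by (intro convex_Int convex_halfspace_Re_le convex_cball)
    show "(?f has_field_derivative (exp (z * of_real \<xi>) - 1) * of_real \<xi>) (at z within ?S)" for z
      by (auto intro!: derivative_eq_intros simp: algebra_simps)
    show "norm ((exp (z * of_real \<xi>) - 1) * of_real \<xi>) \<le> R * \<xi>\<^sup>2" if z: "z \<in> ?S" for z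
    proof -
      have "norm (exp (z * of_real \<xi>) - 1) \<le> norm (z * of_real \<xi>)"
        using z assms(1) by (intro norm_exp_minus_1_le) (auto simp: mult_nonpos_nonneg)
      also have "\<dots> \<le> R * \<xi>" using z assms(1) by (auto simp: norm_mult intro!: mult_right_mono)
      finally show ?thesis using assms(1) by (simp add: norm_mult power2_eq_square mult.assoc[symmetric] mult_right_mono)
    qed
  qed (use assms in auto)
  then show ?thesis by (simp add: mult_ac)
qed

text \<open>From 1 - cos x = 2 sin(x/2)^2 and |sin y| \<le> |y|.\<close>

lemma one_minus_cos_le: "1 - cos x \<le> x\<^sup>2 / 2" for x :: real
proof -
  have "\<bar>sin (x / 2)\<bar>\<^sup>2 \<le> \<bar>x / 2\<bar>\<^sup>2" by (rule power_mono[OF abs_sin_x_le_abs_x]) simp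
  then have "(sin (x / 2))\<^sup>2 \<le> x\<^sup>2 / 4" by (simp add: power_divide)
  with cos_double_sin[of "x / 2"] show ?thesis by simp
qed

locale jump_measure =
  fixes \<nu> :: "real measure"
  assumes nu_measure: "measure_on_Rplus \<nu>"
    and nu_moment: "(\<integral>\<^sup>+\<xi>\<in>{0..}. ennreal (\<bar>\<xi>\<bar>\<^sup>2) \<partial>\<nu>) < \<infinity>"
begin

lemma sets_nu [measurable_cong]: "sets \<nu> = sets borel"
  using nu_measure by (simp add: measure_on_Rplus_def)

lemma second_moment_integrable: "set_integrable \<nu> {0..} (\<lambda>\<xi>. \<xi>\<^sup>2)"
  unfolding set_integrable_def
proof (rule integrableI_bounded)
  have "(\<integral>\<^sup>+\<xi>. ennreal (norm (indicator {0..} \<xi> *\<^sub>R \<xi>\<^sup>2)) \<partial>\<nu>) = (\<integral>\<^sup>+\<xi>\<in>{0..}. ennreal (\<bar>\<xi>\<bar>\<^sup>2) \<partial>\<nu>)"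
    by (intro nn_integral_cong) (auto split: split_indicator)
  with nu_moment show "(\<integral>\<^sup>+\<xi>. ennreal (norm (indicator {0..} \<xi> *\<^sub>R \<xi>\<^sup>2)) \<partial>\<nu>) < \<infinity>" by simp
qed measurable

definition second_moment :: real where "second_moment = (LINT \<xi>:{0..}|\<nu>. \<xi>\<^sup>2)"

lemma second_moment_nonneg: "0 \<le> second_moment"
  unfolding second_moment_def set_lebesgue_integral_def by (intro Bochner_Integration.integral_nonneg) auto

definition jump_exponent :: "complex \<Rightarrow> complex" where
  "jump_exponent u = (LINT \<xi>:{0..}|\<nu>. exp (u * of_real \<xi>) - 1 - u * of_real \<xi>)"

lemma integrand_integrable:
  assumes "Re u \<le> 0"
  shows "set_integrable \<nu> {0..} (\<lambda>\<xi>. exp (u * of_real \<xi>) - 1 - u * of_real \<xi>)"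
proof (rule set_integrable_bound)
  show "set_integrable \<nu> {0..} (\<lambda>\<xi>. (norm u * norm u) * \<xi>\<^sup>2)"
    by (intro set_integrable_mult_right second_moment_integrable)
  show "set_borel_measurable \<nu> {0..} (\<lambda>\<xi>. exp (u * of_real \<xi>) - 1 - u * of_real \<xi>)"
    unfolding set_borel_measurable_def by measurable
  \<comment> \<open>The Lipschitz estimate with R = |u| against v = 0, where the integrand
    vanishes.\<close>
  show "AE \<xi> in \<nu>. \<xi> \<in> {0..} \<longrightarrow>
      norm (exp (u * of_real \<xi>) - 1 - u * of_real \<xi>) \<le> norm ((norm u * norm u) * \<xi>\<^sup>2)"
    using compensated_exp_lipschitz[of _ u 0 "norm u"] assms by (intro AE_I2) auto
qed

lemma jump_exponent_lipschitz:
  assumes "Re u \<le> 0" "Re v \<le> 0" "norm u \<le> R" "norm v \<le> R"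
  shows "norm (jump_exponent u - jump_exponent v) \<le> second_moment * R * norm (u - v)"
proof -
  let ?f = "\<lambda>u \<xi>. exp (u * of_real \<xi>) - 1 - u * complex_of_real \<xi>"
  have int: "set_integrable \<nu> {0..} (\<lambda>\<xi>. ?f u \<xi> - ?f v \<xi>)"
    by (intro set_integral_diff integrand_integrable assms)
  have "norm (jump_exponent u - jump_exponent v) = norm (LINT \<xi>:{0..}|\<nu>. ?f u \<xi> - ?f v \<xi>)"
    unfolding jump_exponent_def
    by (subst set_integral_diff(2)) (auto intro: integrand_integrable assms)
  also have "\<dots> \<le> (LINT \<xi>:{0..}|\<nu>. norm (?f u \<xi> - ?f v \<xi>))"
    by (rule set_integral_norm_bound[OF int])
  also have "\<dots> \<le> (LINT \<xi>:{0..}|\<nu>. (R * norm (u - v)) * \<xi>\<^sup>2)"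
    by (intro set_integral_mono set_integrable_mult_right second_moment_integrable
      set_integrable_norm[OF int] compensated_exp_lipschitz assms) auto
  also have "\<dots> = second_moment * R * norm (u - v)" by (simp add: second_moment_def)
  finally show ?thesis .
qed

lemma Re_jump_exponent:
  assumes "Re u \<le> 0"
  shows "set_integrable \<nu> {0..} (\<lambda>\<xi>. exp (Re u * \<xi>) * cos (Im u * \<xi>) - 1 - Re u * \<xi>)" (is ?int)
    and "Re (jump_exponent u) = (LINT \<xi>:{0..}|\<nu>. exp (Re u * \<xi>) * cos (Im u * \<xi>) - 1 - Re u * \<xi>)" (is ?eq)
proof -
  note int = integrand_integrable[OF assms, unfolded set_integrable_def]
  have eq: "Re (indicator {0..} \<xi> *\<^sub>R (exp (u * of_real \<xi>) - 1 - u * of_real \<xi>))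
      = indicator {0..} \<xi> *\<^sub>R (exp (Re u * \<xi>) * cos (Im u * \<xi>) - 1 - Re u * \<xi>)" for \<xi>
    by (simp add: Re_exp)
  show ?int using integrable_Re[OF int] unfolding eq set_integrable_def .
  show ?eq using integral_Re[OF int] unfolding eq jump_exponent_def set_lebesgue_integral_def by simp
qed

lemma Im_jump_exponent:
  assumes "Re u \<le> 0"
  shows "Im (jump_exponent u) = (LINT \<xi>:{0..}|\<nu>. exp (Re u * \<xi>) * sin (Im u * \<xi>) - Im u * \<xi>)"
proof -
  note int = integrand_integrable[OF assms, unfolded set_integrable_def]
  have eq: "Im (indicator {0..} \<xi> *\<^sub>R (exp (u * of_real \<xi>) - 1 - u * of_real \<xi>))
      = indicator {0..} \<xi> *\<^sub>R (exp (Re u * \<xi>) * sin (Im u * \<xi>) - Im u * \<xi>)" for \<xi>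
    by (simp add: Im_exp)
  show ?thesis using integral_Im[OF int] unfolding eq jump_exponent_def set_lebesgue_integral_def by simp
qed

lemma jump_exponent_of_real:
  "jump_exponent (of_real x) = of_real (LINT \<xi>:{0..}|\<nu>. exp (x * \<xi>) - 1 - x * \<xi>)"
proof -
  have "indicator {0..} \<xi> *\<^sub>R (exp (of_real x * of_real \<xi>) - 1 - of_real x * of_real \<xi>)
      = complex_of_real (indicator {0..} \<xi> *\<^sub>R (exp (x * \<xi>) - 1 - x * \<xi>))" for \<xi>
    using exp_of_real[of "x * \<xi>", where 'a = complex] by (auto split: split_indicator)
  then show ?thesis by (simp only: jump_exponent_def set_lebesgue_integral_def integral_complex_of_real)
qed

lemma Re_jump_exponent_le:
  assumes "Re u \<le> 0"
  shows "Re (jump_exponent u) \<le> Re (jump_exponent (of_real (Re u)))"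
proof -
  \<comment> \<open>The bound cos \<le> 1 under the integral; the factor
    \<open>cos (0 * \<xi>)\<close> keeps the form of the integrand at the real point Re u.\<close>
  have "Re (jump_exponent u) \<le> (LINT \<xi>:{0..}|\<nu>. exp (Re u * \<xi>) * cos (0 * \<xi>) - 1 - Re u * \<xi>)"
    unfolding Re_jump_exponent(2)[OF assms]
    using Re_jump_exponent(1)[of "of_real (Re u)"] assms
    by (intro set_integral_mono Re_jump_exponent) auto
  then show ?thesis using Re_jump_exponent(2)[of "of_real (Re u)"] assms by simp
qed

text \<open>With x = Re u \<xi> and y = Im u \<xi>, the integrand is (exp(x) - 1 - x) - exp(x) (1 -
  cos y), which is at least -y^2 / 2 since x \<le> 0.\<close>

lemma Re_jump_exponent_ge:
  assumes "Re u \<le> 0"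
  shows "- (second_moment / 2) * (Im u)\<^sup>2 \<le> Re (jump_exponent u)"
proof -
  have "- (second_moment / 2) * (Im u)\<^sup>2 = (LINT \<xi>:{0..}|\<nu>. - ((Im u)\<^sup>2 / 2) * \<xi>\<^sup>2)"
    by (simp only: second_moment_def set_integral_mult_right) simp
  also have "\<dots> \<le> Re (jump_exponent u)"
    unfolding Re_jump_exponent(2)[OF assms]
  proof (intro set_integral_mono set_integrable_mult_right second_moment_integrable Re_jump_exponent assms)
    fix \<xi> :: real assume "\<xi> \<in> {0..}"
    then have e: "exp (Re u * \<xi>) \<le> 1" using assms by (auto simp: mult_nonpos_nonneg)
    have "exp (Re u * \<xi>) * (1 - cos (Im u * \<xi>)) \<le> 1 * (1 - cos (Im u * \<xi>))"
      using e by (intro mult_right_mono) auto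
    also have "\<dots> \<le> (Im u * \<xi>)\<^sup>2 / 2" using one_minus_cos_le by simp
    finally have "exp (Re u * \<xi>) - exp (Re u * \<xi>) * cos (Im u * \<xi>) \<le> (Im u)\<^sup>2 / 2 * \<xi>\<^sup>2"
      by (simp add: power_mult_distrib algebra_simps)
    with exp_ge_add_one_self[of "Re u * \<xi>"]
    show "- ((Im u)\<^sup>2 / 2) * \<xi>\<^sup>2 \<le> exp (Re u * \<xi>) * cos (Im u * \<xi>) - 1 - Re u * \<xi>"
      unfolding mult_minus_left by linarith
  qed
  finally show ?thesis .
qed

text \<open>This symmetry transfers bounds from Im u \<ge> 0 to Im u \<le> 0.\<close>

lemma jump_exponent_cnj: "jump_exponent (cnj u) = cnj (jump_exponent u)"
proof -
  have "indicator {0..} \<xi> *\<^sub>R (exp (cnj u * of_real \<xi>) - 1 - cnj u * of_real \<xi>)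
      = cnj (indicator {0..} \<xi> *\<^sub>R (exp (u * of_real \<xi>) - 1 - u * of_real \<xi>))" for \<xi>
    by (simp add: exp_cnj)
  then show ?thesis by (simp only: jump_exponent_def set_lebesgue_integral_def Bochner_Integration.integral_cnj)
qed

text \<open>Pointwise, exp(x) sin y \<le> y for x \<le> 0 \<le> y: by damping and sin y \<le> y if
  sin y \<ge> 0, and by sign otherwise.\<close>

lemma Im_jump_exponent_nonpos:
  assumes "Re u \<le> 0" "0 \<le> Im u"
  shows "Im (jump_exponent u) \<le> 0"
proof -
  have "exp (Re u * \<xi>) * sin (Im u * \<xi>) - Im u * \<xi> \<le> 0" if "0 \<le> \<xi>" for \<xi>
  proof (cases "0 \<le> sin (Im u * \<xi>)")
    case True
    have "exp (Re u * \<xi>) * sin (Im u * \<xi>) \<le> 1 * sin (Im u * \<xi>)"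
      using assms that True by (intro mult_right_mono) (auto simp: mult_nonpos_nonneg)
    with sin_x_le_x[of "Im u * \<xi>"] assms that show ?thesis by simp
  next
    case False
    then have "exp (Re u * \<xi>) * sin (Im u * \<xi>) \<le> 0" by (simp add: mult_nonneg_nonpos)
    moreover have "0 \<le> Im u * \<xi>" using assms that by simp
    ultimately show ?thesis by linarith
  qed
  then have "0 \<le> (LINT \<xi>|\<nu>. - (indicator {0..} \<xi> *\<^sub>R (exp (Re u * \<xi>) * sin (Im u * \<xi>) - Im u * \<xi>)))"
    by (intro Bochner_Integration.integral_nonneg) (auto split: split_indicator)
  then show ?thesis
    unfolding Im_jump_exponent[OF assms(1)] set_lebesgue_integral_def by simp
qed

end

section \<open>The branching mechanism, the time-independent part of F\<close>

context jump_measure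
begin

definition branching :: "real \<Rightarrow> real \<Rightarrow> complex \<Rightarrow> complex" where
  "branching b c u = of_real b * u + of_real (c / 2) * u\<^sup>2 + jump_exponent u"

lemma riccati_F_eq: "riccati_F f b c \<nu> t u = f t + branching b c u"
  by (simp add: riccati_F_def branching_def jump_exponent_def add.assoc)

text \<open>The branching mechanism is real on the real axis, so one complex function serves both
  equations.\<close>

lemma riccati_Fbar_eq: "riccati_Fbar f b c \<nu> t x = Re (f t) + Re (branching b c (of_real x))"
  by (simp add: riccati_Fbar_def branching_def jump_exponent_of_real power2_eq_square)

lemma branching_lipschitz:
  "\<exists>C. \<forall>u v. Re u \<le> 0 \<longrightarrow> Re v \<le> 0 \<longrightarrow> norm u \<le> R \<longrightarrow> norm v \<le> R \<longrightarrow>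
    norm (branching b c u - branching b c v) \<le> C * norm (u - v)"
proof (intro exI allI impI)
  fix u v :: complex
  assume uv: "Re u \<le> 0" "Re v \<le> 0" "norm u \<le> R" "norm v \<le> R"
  have "branching b c u - branching b c v
      = (of_real b + of_real (c / 2) * (u + v)) * (u - v) + (jump_exponent u - jump_exponent v)"
    by (simp add: branching_def power2_eq_square field_simps)
  also have "norm \<dots> \<le> norm (of_real b + of_real (c / 2) * (u + v)) * norm (u - v)
      + second_moment * R * norm (u - v)"
    by (rule order_trans[OF norm_triangle_ineq])
      (auto simp: norm_mult intro!: add_mono jump_exponent_lipschitz uv)
  also have "norm (of_real b + of_real (c / 2) * (u + v)) \<le> \<bar>b\<bar> + \<bar>c / 2\<bar> * (R + R)"
  proof -
    have "norm (u + v) \<le> R + R" using norm_triangle_ineq[of u v] uv by linarith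
    then have "norm (of_real (c / 2) * (u + v)) \<le> \<bar>c / 2\<bar> * (R + R)"
      by (simp only: norm_mult norm_of_real mult_left_mono abs_ge_zero)
    then show ?thesis using norm_triangle_ineq[of "of_real b" "of_real (c / 2) * (u + v)"]
      by (simp only: norm_of_real)
  qed
  finally show "norm (branching b c u - branching b c v)
      \<le> (\<bar>b\<bar> + \<bar>c / 2\<bar> * (R + R) + second_moment * R) * norm (u - v)"
    by (simp add: distrib_right mult_right_mono)
qed

lemma branching_continuous: "continuous_on {u. Re u \<le> 0} (branching b c)"
  by (rule halfplane_lipschitz_continuous[OF branching_lipschitz])

text \<open>Dropping Im u can only increase the real part: Re(u^2) = (Re u)^2 - (Im u)^2, and cos
  \<le> 1 in the jump part.\<close>

lemma Re_branching_le:
  assumes "0 \<le> c" "Re u \<le> 0"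
  shows "Re (branching b c u) \<le> Re (branching b c (of_real (Re u)))"
proof -
  have "Re (of_real (c / 2) * u\<^sup>2) \<le> Re (of_real (c / 2) * (of_real (Re u))\<^sup>2)"
    using assms(1) by (simp add: power2_eq_square mult_left_mono)
  with Re_jump_exponent_le[OF assms(2)] show ?thesis by (simp add: branching_def)
qed

text \<open>Comparison with the real point 0, where the branching mechanism vanishes.\<close>

lemma Re_branching_imaginary:
  assumes "0 \<le> c" "Re u = 0"
  shows "Re (branching b c u) \<le> 0"
  using Re_branching_le[OF assms(1), of u b] assms(2) by (simp add: branching_def jump_exponent_def)

text \<open>The term c/2 (Re u)^2 is dropped; the quadratic and the jump part lose c/2 and half the
  second moment times (Im u)^2.\<close>

lemma Re_branching_ge:
  assumes "0 \<le> c" "Re u \<le> 0"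
  shows "b * Re u - ((c + second_moment) / 2) * (Im u)\<^sup>2 \<le> Re (branching b c u)"
proof -
  have "0 \<le> c / 2 * (Re u)\<^sup>2" using assms(1) by simp
  moreover have "Re (branching b c u) = b * Re u + c / 2 * (Re u)\<^sup>2 - c / 2 * (Im u)\<^sup>2 + Re (jump_exponent u)"
    by (simp add: branching_def power2_eq_square field_simps)
  moreover have "((c + second_moment) / 2) * (Im u)\<^sup>2 = c / 2 * (Im u)\<^sup>2 + second_moment / 2 * (Im u)\<^sup>2"
    by (simp add: field_simps)
  ultimately show ?thesis using Re_jump_exponent_ge[OF assms(2)] by linarith
qed

text \<open>The quadratic term contributes c Re u Im u \<le> 0, and the jump part is nonpositive as
  well.\<close>

lemma Im_branching_le:
  assumes "0 \<le> c" "Re u \<le> 0" "0 \<le> Im u"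
  shows "Im (branching b c u) \<le> b * Im u"
proof -
  have "Im (branching b c u) = b * Im u + c * (Re u * Im u) + Im (jump_exponent u)"
    by (simp add: branching_def power2_eq_square)
  moreover have "c * (Re u * Im u) \<le> 0" using assms by (intro mult_nonneg_nonpos mult_nonpos_nonneg)
  ultimately show ?thesis using Im_jump_exponent_nonpos[OF assms(2,3)] by linarith
qed

lemma branching_cnj: "branching b c (cnj u) = cnj (branching b c u)"
  by (simp add: branching_def jump_exponent_cnj)

lemma Im_branching_ge:
  assumes "0 \<le> c" "Re u \<le> 0" "Im u \<le> 0"
  shows "b * Im u \<le> Im (branching b c u)"
  using Im_branching_le[of c "cnj u" b] assms by (simp add: branching_cnj)

end

section \<open>Existence and comparison for the given data\<close>

lemma continuous_volterra_solution_iff: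
  "continuous_volterra_solution K G D \<psi> \<longleftrightarrow>
    continuous_on {0..} \<psi> \<and> \<psi> \<in> {0..} \<rightarrow> D \<and> (\<forall>t\<ge>0. \<psi> t = volterra K (\<lambda>s. G s (\<psi> s)) t)"
  by (simp add: continuous_volterra_solution_def volterra_def)

text \<open>On a bounded interval |K| is dominated by the integrable function 1 + K^2.\<close>

lemma L2_loc_imp_integrable:
  assumes "L2_loc K"
  shows "set_integrable lborel {0..T} K"
proof (cases "0 \<le> T")
  case True
  show ?thesis
  proof (rule set_integrable_bound)
    show "set_integrable lborel {0..T} (\<lambda>t. 1 + (K t)\<^sup>2)"
      using assms True
      by (intro set_integral_add) (auto simp: L2_loc_def intro!: borel_integrable_atLeastAtMost')
    have "set_borel_measurable lborel {0..} K" using assms by (simp add: L2_loc_def)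
    then show "set_borel_measurable lborel {0..T} K"
      by (rule set_borel_measurable_subset) auto
    show "AE t in lborel. t \<in> {0..T} \<longrightarrow> norm (K t) \<le> norm (1 + (K t)\<^sup>2)"
    proof (intro AE_I2 impI)
      fix t
      have "0 \<le> (\<bar>K t\<bar> - 1)\<^sup>2" by simp
      then have "2 * \<bar>K t\<bar> \<le> 1 + (K t)\<^sup>2" by (simp add: power2_diff)
      then show "norm (K t) \<le> norm (1 + (K t)\<^sup>2)" by simp
    qed
  qed
qed (simp add: set_integrable_def)

theorem theorem10:
  fixes f :: "real \<Rightarrow> complex" and K :: "real \<Rightarrow> real"
    and L \<nu> :: "real measure" and b c :: real
  assumes f_cont: "continuous_on {0..} f"
    and f_range: "f \<in> {0..} \<rightarrow> complex_nonpos"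
    and K_L2: "L2_loc K"
    and K_nonneg: "\<forall>t>0. K t \<ge> 0"
    and K_antimono: "antimono_on {0<..} K"
    and K_nonzero: "\<exists>t>0. K t \<noteq> 0"
    and K_C1: "K C1_differentiable_on {0<..}"
    and L_resolvent: "resolvent_first_kind K L"
    and L_antimono: "nonincreasing_measure L"
    and c_nonneg: "c \<ge> 0"
    and nu_measure: "measure_on_Rplus \<nu>"
    and nu_zero: "emeasure \<nu> {0} = 0"
    and nu_moment: "(\<integral>\<^sup>+\<xi>\<in>{0..}. ennreal (\<bar>\<xi>\<bar>\<^sup>2) \<partial>\<nu>) < \<infinity>"
  shows "((\<exists>\<psi>. continuous_volterra_solution K (riccati_F f b c \<nu>) complex_nonpos \<psi>) \<and>
          (\<exists>\<psi>bar. continuous_volterra_solution K (riccati_Fbar f b c \<nu>) {..0} \<psi>bar)) \<and>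
         (\<forall>\<psi> \<psi>bar.
            continuous_volterra_solution K (riccati_F f b c \<nu>) complex_nonpos \<psi> \<longrightarrow>
            continuous_volterra_solution K (riccati_Fbar f b c \<nu>) {..0} \<psi>bar \<longrightarrow>
            (\<forall>t\<ge>0. Re (\<psi> t) \<le> \<psi>bar t))"
proof -
  interpret resolvent_kernel K L
    by unfold_locales
      (use K_nonneg K_antimono K_C1 L_resolvent L_antimono in \<open>auto intro: L2_loc_imp_integrable[OF K_L2]\<close>)
  interpret jump_measure \<nu> by unfold_locales (fact nu_measure nu_moment)+
  have f_nonpos: "Re (f t) \<le> 0" if "0 \<le> t" for t
    using f_range that by (auto simp: complex_nonpos_def)
  let ?\<Phi> = "branching b c"
  have existence: "\<exists>\<psi>. continuous_on {0..} \<psi> \<and> (\<forall>t\<ge>0. Re (\<psi> t) \<le> 0) \<and>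
      (\<forall>t\<ge>0. \<psi> t = volterra K (\<lambda>s. g s + ?\<Phi> (\<psi> s)) t)"
    if g: "continuous_on {0..} g" "\<And>t. 0 \<le> t \<Longrightarrow> Re (g t) \<le> 0" for g
  proof -
    have "0 \<le> (c + second_moment) / 2" using c_nonneg second_moment_nonneg by simp
    from complex_riccati_existence[OF g branching_lipschitz Re_branching_imaginary[OF c_nonneg]
        this Re_branching_ge[OF c_nonneg] Im_branching_le[OF c_nonneg] Im_branching_ge[OF c_nonneg]]
    show ?thesis by blast
  qed
  have \<Phi>_cont: "continuous_on {0..} (\<lambda>s. g s + ?\<Phi> (\<psi> s))"
    if "continuous_on {0..} g" "continuous_on {0..} \<psi>" "\<And>t. 0 \<le> t \<Longrightarrow> Re (\<psi> t) \<le> 0" for g \<psi>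
    by (intro continuous_intros that continuous_on_compose2[OF branching_continuous]) (use that(3) in auto)
  have "\<exists>\<psi>. continuous_volterra_solution K (riccati_F f b c \<nu>) complex_nonpos \<psi>"
    using existence[OF f_cont f_nonpos]
    by (auto simp: continuous_volterra_solution_iff riccati_F_eq complex_nonpos_def)
  \<comment> \<open>The complex existence result is applied to the real forcing Re f; the solution
    is then real, and its real part solves (2).\<close>
  moreover have "\<exists>\<psi>bar. continuous_volterra_solution K (riccati_Fbar f b c \<nu>) {..0} \<psi>bar"
  proof -
    let ?g = "\<lambda>t. complex_of_real (Re (f t))"
    have g: "continuous_on {0..} ?g" by (intro continuous_intros f_cont)
    obtain \<psi> where \<psi>: "continuous_on {0..} \<psi>" "\<And>t. 0 \<le> t \<Longrightarrow> Re (\<psi> t) \<le> 0"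
      "\<And>t. 0 \<le> t \<Longrightarrow> \<psi> t = volterra K (\<lambda>s. ?g s + ?\<Phi> (\<psi> s)) t"
      using existence[OF g] f_nonpos by auto
    note cont = \<Phi>_cont[OF g \<psi>(1,2)]
    have Im: "Im (\<psi> t) = 0" if "0 \<le> t" for t
      by (rule complex_riccati_real[where f = ?g and \<Phi> = ?\<Phi>, OF cont \<psi>(2,3) _ Im_branching_le[OF c_nonneg] Im_branching_ge[OF c_nonneg] that]) simp_all
    have "Re (\<psi> t) = volterra K (\<lambda>s. riccati_Fbar f b c \<nu> s (Re (\<psi> s))) t" if t: "0 \<le> t" for t
    proof -
      have "Re (\<psi> t) = volterra K (\<lambda>s. Re (?g s + ?\<Phi> (\<psi> s))) t"
        using \<psi>(3)[OF t] volterra_Re[OF continuous_on_atLeast_imp_Icc[OF cont]] by simp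
      also have "\<dots> = volterra K (\<lambda>s. riccati_Fbar f b c \<nu> s (Re (\<psi> s))) t"
      proof (rule volterra_cong)
        fix s :: real assume "0 \<le> s"
        then have "of_real (Re (\<psi> s)) = \<psi> s" using Im by (simp add: complex_eq_iff)
        then show "Re (?g s + ?\<Phi> (\<psi> s)) = riccati_Fbar f b c \<nu> s (Re (\<psi> s))"
          by (simp add: riccati_Fbar_eq)
      qed
      finally show ?thesis .
    qed
    then have "continuous_volterra_solution K (riccati_Fbar f b c \<nu>) {..0} (\<lambda>t. Re (\<psi> t))"
      using \<psi>(2) by (auto simp: continuous_volterra_solution_iff intro!: continuous_intros \<psi>(1))
    then show ?thesis by blast
  qed
  moreover have "Re (\<psi> t) \<le> x t"
    if \<psi>: "continuous_volterra_solution K (riccati_F f b c \<nu>) complex_nonpos \<psi>"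
      and x: "continuous_volterra_solution K (riccati_Fbar f b c \<nu>) {..0} x" and t: "0 \<le> t" for \<psi> x t
  proof -
    have \<psi>': "continuous_on {0..} \<psi>" "\<And>t. 0 \<le> t \<Longrightarrow> Re (\<psi> t) \<le> 0"
      "\<And>t. 0 \<le> t \<Longrightarrow> \<psi> t = volterra K (\<lambda>s. f s + ?\<Phi> (\<psi> s)) t"
      using \<psi> unfolding continuous_volterra_solution_iff riccati_F_eq complex_nonpos_def Pi_iff atLeast_iff mem_Collect_eq
      by blast+
    have x': "continuous_on {0..} x" "\<And>t. 0 \<le> t \<Longrightarrow> x t \<le> 0"
      "\<And>t. 0 \<le> t \<Longrightarrow> x t = volterra K (\<lambda>s. Re (f s) + Re (?\<Phi> (of_real (x s)))) t"
      using x unfolding continuous_volterra_solution_iff riccati_Fbar_eq Pi_iff atLeast_iff atMost_iff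
      by blast+
    show ?thesis
    \<comment> \<open>The scalar nonlinearity is the branching mechanism on the real axis and
      inherits its Lipschitz bounds.\<close>
    proof (rule riccati_comparison[where \<Phi> = ?\<Phi> and \<phi> = "\<lambda>r. Re (?\<Phi> (of_real r))", OF _ _ \<psi>' x' _ _ t])
      show "continuous_on {0..} (\<lambda>s. f s + ?\<Phi> (\<psi> s))" by (rule \<Phi>_cont[OF f_cont \<psi>'(1,2)])
      have "continuous_on {0..} (\<lambda>s. complex_of_real (x s))" by (intro continuous_intros x')
      from continuous_on_Re[OF \<Phi>_cont[OF f_cont this]] x'(2)
      show "continuous_on {0..} (\<lambda>s. Re (f s) + Re (?\<Phi> (of_real (x s))))" by simp
      show "Re (?\<Phi> u) \<le> Re (?\<Phi> (of_real (Re u)))" if "Re u \<le> 0" for u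
        by (rule Re_branching_le[OF c_nonneg that])
      show "\<exists>C. \<forall>r s. r \<le> 0 \<longrightarrow> s \<le> 0 \<longrightarrow> \<bar>r\<bar> \<le> R \<longrightarrow> \<bar>s\<bar> \<le> R \<longrightarrow>
          \<bar>Re (?\<Phi> (of_real r)) - Re (?\<Phi> (of_real s))\<bar> \<le> C * \<bar>r - s\<bar>" for R
      proof -
        obtain C where C: "\<And>u v. Re u \<le> 0 \<Longrightarrow> Re v \<le> 0 \<Longrightarrow> norm u \<le> R \<Longrightarrow> norm v \<le> R \<Longrightarrow>
            norm (?\<Phi> u - ?\<Phi> v) \<le> C * norm (u - v)"
          using branching_lipschitz[of R b c] by blast
        have "\<bar>Re (?\<Phi> (of_real r)) - Re (?\<Phi> (of_real s))\<bar> \<le> C * \<bar>r - s\<bar>"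
          if "r \<le> 0" "s \<le> 0" "\<bar>r\<bar> \<le> R" "\<bar>s\<bar> \<le> R" for r s
        proof -
          have "\<bar>Re (?\<Phi> (of_real r) - ?\<Phi> (of_real s))\<bar> \<le> C * norm (complex_of_real r - of_real s)"
            by (rule order_trans[OF abs_Re_le_cmod C]) (use that in auto)
          then show ?thesis by (simp flip: of_real_diff)
        qed
        then show ?thesis by blast
      qed
    qed
  qed
  ultimately show ?thesis by blast
qed

end
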